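(* Let $K$ be a field (with the standing assumption on $\mathrm{char}(K)$ given in the context). For any integer $a\ge -1$, there exist an integer $n>0$ and a monomial ideal $I\subset S=K[x_1,\dots,x_n]$ with linear resolution such that $$\mathrm{reg}\,\partial(I)-\mathrm{reg}\,I=a.$$
   Context: $S=K[x_1,\dots,x_n]$ is the standard graded polynomial ring over the field $K$. For a homogeneous ideal $I\subset S$, the gradient ideal $\partial(I)$ is the ideal generated by all partial derivatives $\partial f/\partial x_i$ ($1\le i\le n$) of the elements $f$ of a minimal generating set of $I$. For a monomial ideal $I$, $\mathcal{G}(I)$ denotes its minimal monomial generating set, and $\mathrm{supp}(u)=\{i: x_i \text{ divides } u\}$ for a monomial $u$. Standing assumption: $\mathrm{char}(K)=0$, or $\mathrm{char}(K)$ is large enough that for every monomial ideal $I$ under consideration $$\partial(I)=(u/x_i:\ u\in\mathcal{G}(I),\ i\in\mathrm{supp}(u)).$$ For a homogeneous ideal $I$, $\mathrm{reg}\,I=\max\{j-i:\ \dim_K\mathrm{Tor}^S_i(K,I)_j\neq 0\}$ is the Castelnuovo–Mumford regularity of $I$. The ideal $I$ has a $d$-linear resolution if all its minimal homogeneous generators have degree $d$ and $\mathrm{reg}\,I=d$; it has linear resolution if it has a $d$-linear resolution for some $d$. *)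

theory Defs
  imports "HOL-Algebra.Ideal" "HOL-Library.Poly_Mapping" "HOL-Library.Extended_Real"
begin

section \<open>The standard graded polynomial ring\<close>

text \<open>
  Monomials are exponent vectors. Since the number of variables is quantified inside statements,
  all polynomials live in one type with variables indexed by the natural numbers, and
  \<open>polyring n\<close> is the ring of polynomials in the variables with indices \<open>0, \<dots>, n - 1\<close>.
\<close>

type_synonym 'k mpoly = "(nat \<Rightarrow>\<^sub>0 nat) \<Rightarrow>\<^sub>0 'k"

definition polyring :: "nat \<Rightarrow> ('k::field) mpoly ring" where
  "polyring n = \<lparr>carrier = {p. \<forall>m\<in>Poly_Mapping.keys p. Poly_Mapping.keys m \<subseteq> {..<n}},
                 mult = (*), one = 1, zero = 0, add = (+)\<rparr>"

definition mono_deg :: "(nat \<Rightarrow>\<^sub>0 nat) \<Rightarrow> nat" where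
  "mono_deg m = (\<Sum>i\<in>Poly_Mapping.keys m. Poly_Mapping.lookup m i)"

text \<open>Degrees are integers, so that \<open>homogeneous p e\<close> with \<open>e < 0\<close> forces \<open>p = 0\<close>.\<close>

definition homogeneous :: "('k::field) mpoly \<Rightarrow> int \<Rightarrow> bool" where
  "homogeneous p e \<longleftrightarrow> (\<forall>m\<in>Poly_Mapping.keys p. int (mono_deg m) = e)"

definition monomial :: "(nat \<Rightarrow>\<^sub>0 nat) \<Rightarrow> ('k::field) mpoly" where
  "monomial m = Poly_Mapping.single m 1"

definition monomials :: "nat \<Rightarrow> ('k::field) mpoly set" where
  "monomials n = monomial ` {m. Poly_Mapping.keys m \<subseteq> {..<n}}"

definition partial_deriv :: "nat \<Rightarrow> ('k::field) mpoly \<Rightarrow> 'k mpoly" where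
  "partial_deriv i p =
    (\<Sum>m\<in>Poly_Mapping.keys p.
       Poly_Mapping.single (m - Poly_Mapping.single i 1)
         (of_nat (Poly_Mapping.lookup m i) * Poly_Mapping.lookup p m))"


section \<open>Monomial ideals, minimal generators and gradient ideals\<close>

definition monomial_ideal :: "nat \<Rightarrow> ('k::field) mpoly set \<Rightarrow> bool" where
  "monomial_ideal n I \<longleftrightarrow> (\<exists>A\<subseteq>monomials n. I = Idl\<^bsub>polyring n\<^esub> A)"

definition minimal_generating_set ::
  "nat \<Rightarrow> ('k::field) mpoly set \<Rightarrow> 'k mpoly set \<Rightarrow> bool" where
  "minimal_generating_set n I G \<longleftrightarrow>
     G \<subseteq> carrier (polyring n) \<and> Idl\<^bsub>polyring n\<^esub> G = I \<and> (\<forall>H. H \<subset> G \<longrightarrow> Idl\<^bsub>polyring n\<^esub> H \<noteq> I)"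

definition minimal_homogeneous_generating_set ::
  "nat \<Rightarrow> ('k::field) mpoly set \<Rightarrow> 'k mpoly set \<Rightarrow> bool" where
  "minimal_homogeneous_generating_set n I G \<longleftrightarrow>
     minimal_generating_set n I G \<and> (\<forall>g\<in>G. \<exists>e. homogeneous g e)"

text \<open>The set \<open>\<G>(I)\<close>, which exists and is unique for a monomial ideal \<open>I\<close>.\<close>

definition minimal_monomial_generators ::
  "nat \<Rightarrow> ('k::field) mpoly set \<Rightarrow> 'k mpoly set" where
  "minimal_monomial_generators n I =
     (THE G. G \<subseteq> monomials n \<and> minimal_generating_set n I G)"

text \<open>
  As usual for a homogeneous ideal, the minimal generating set consists of homogeneous elements.
  By Euler's formula the ideal does not depend on its choice in characteristic zero.
\<close>

definition gradient_ideal :: "nat \<Rightarrow> ('k::field) mpoly set \<Rightarrow> 'k mpoly set" where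
  "gradient_ideal n I =
     Idl\<^bsub>polyring n\<^esub> {partial_deriv i f | i f.
        i < n \<and> f \<in> (SOME G. minimal_homogeneous_generating_set n I G)}"

text \<open>
  The condition on the characteristic of the field, relative to the monomial ideal \<open>I\<close>:
  \<open>\<partial>(I) = (u / x\<^sub>i : u \<in> \<G>(I), i \<in> supp(u))\<close>. It holds for all \<open>I\<close> in characteristic zero.
\<close>

definition gradient_by_monomials :: "nat \<Rightarrow> ('k::field) mpoly set \<Rightarrow> bool" where
  "gradient_by_monomials n I \<longleftrightarrow>
     gradient_ideal n I =
       Idl\<^bsub>polyring n\<^esub> {monomial (m - Poly_Mapping.single i 1) | m i.
          monomial m \<in> minimal_monomial_generators n I \<and> i \<in> Poly_Mapping.keys m}"


section \<open>Tor and Castelnuovo--Mumford regularity\<close>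

text \<open>
  A complex of graded free modules of finite rank over \<open>S = polyring n\<close>: the module in homological
  degree \<open>i\<close> is the direct sum of the \<open>S(-gen_deg C i b)\<close> over \<open>b < rk C i\<close>, and the \<open>c\<close>-th basis
  element of the module in degree \<open>i + 1\<close> is mapped to the vector with entries \<open>dmat C i b c\<close>
  (\<open>b < rk C i\<close>).
\<close>

record (overloaded) 'k free_complex =
  rk :: "nat \<Rightarrow> nat"
  gen_deg :: "nat \<Rightarrow> nat \<Rightarrow> int"
  dmat :: "nat \<Rightarrow> nat \<Rightarrow> nat \<Rightarrow> 'k mpoly"

text \<open>
  For \<open>M = S\<close> this is the free module in homological degree \<open>i\<close>; for an ideal \<open>M\<close> it is its
  tensor product with \<open>M\<close>, a direct sum of shifted copies of \<open>M\<close>.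
\<close>

definition chains :: "'k::field free_complex \<Rightarrow> 'k mpoly set \<Rightarrow> nat \<Rightarrow> (nat \<Rightarrow> 'k mpoly) set" where
  "chains C M i = {v. (\<forall>b<rk C i. v b \<in> M) \<and> (\<forall>b\<ge>rk C i. v b = 0)}"

definition graded_chains ::
  "'k::field free_complex \<Rightarrow> 'k mpoly set \<Rightarrow> nat \<Rightarrow> int \<Rightarrow> (nat \<Rightarrow> 'k mpoly) set" where
  "graded_chains C M i j =
     {v \<in> chains C M i. \<forall>b<rk C i. homogeneous (v b) (j - gen_deg C i b)}"

definition boundary ::
  "'k::field free_complex \<Rightarrow> nat \<Rightarrow> (nat \<Rightarrow> 'k mpoly) \<Rightarrow> nat \<Rightarrow> 'k mpoly" where
  "boundary C i v = (\<lambda>b. if b < rk C i then \<Sum>c<rk C (Suc i). dmat C i b c * v c else 0)"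

text \<open>
  The augmentation onto the residue field \<open>K = S / (x\<^sub>1, \<dots>, x\<^sub>n)\<close>, concentrated in degree zero, sends
  the \<open>b\<close>-th basis element to \<open>\<epsilon> b\<close>; a polynomial acts on \<open>K\<close> through its constant coefficient.
\<close>

definition augmentation ::
  "'k::field free_complex \<Rightarrow> (nat \<Rightarrow> 'k) \<Rightarrow> (nat \<Rightarrow> 'k mpoly) \<Rightarrow> 'k" where
  "augmentation C \<epsilon> v = (\<Sum>b<rk C 0. Poly_Mapping.lookup (v b) 0 * \<epsilon> b)"

definition graded_free_resolution_of_residue_field ::
  "nat \<Rightarrow> 'k::field free_complex \<Rightarrow> (nat \<Rightarrow> 'k) \<Rightarrow> bool" where
  "graded_free_resolution_of_residue_field n C \<epsilon> \<longleftrightarrow>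
     (\<forall>i. \<forall>b<rk C i. \<forall>c<rk C (Suc i).
        dmat C i b c \<in> carrier (polyring n) \<and>
        homogeneous (dmat C i b c) (gen_deg C (Suc i) c - gen_deg C i b)) \<and>
     (\<forall>b<rk C 0. \<epsilon> b \<noteq> 0 \<longrightarrow> gen_deg C 0 b = 0) \<and>
     (\<exists>b<rk C 0. \<epsilon> b \<noteq> 0) \<and>
     {v \<in> chains C (carrier (polyring n)) 0. augmentation C \<epsilon> v = 0} =
       boundary C 0 ` chains C (carrier (polyring n)) 1 \<and>
     (\<forall>i. {v \<in> chains C (carrier (polyring n)) (Suc i). boundary C i v = (\<lambda>_. 0)} =
       boundary C (Suc i) ` chains C (carrier (polyring n)) (Suc (Suc i)))"

definition graded_cycles ::
  "'k::field free_complex \<Rightarrow> 'k mpoly set \<Rightarrow> nat \<Rightarrow> int \<Rightarrow> (nat \<Rightarrow> 'k mpoly) set" where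
  "graded_cycles C M i j =
     {v \<in> graded_chains C M i j. case i of 0 \<Rightarrow> True | Suc k \<Rightarrow> boundary C k v = (\<lambda>_. 0)}"

definition graded_boundaries ::
  "'k::field free_complex \<Rightarrow> 'k mpoly set \<Rightarrow> nat \<Rightarrow> int \<Rightarrow> (nat \<Rightarrow> 'k mpoly) set" where
  "graded_boundaries C M i j = boundary C i ` graded_chains C M (Suc i) j"

text \<open>
  \<open>Tor\<^sub>i(K, I)\<^sub>j \<noteq> 0\<close>, where \<open>Tor\<^sub>i(K, I)\<close> is the \<open>i\<close>-th homology of \<open>P \<otimes> I\<close> for a graded free
  resolution \<open>P\<close> of \<open>K\<close>. It does not depend on the resolution up to graded isomorphism.
\<close>

definition Tor_nonzero :: "nat \<Rightarrow> ('k::field) mpoly set \<Rightarrow> nat \<Rightarrow> int \<Rightarrow> bool" where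
  "Tor_nonzero n I i j \<longleftrightarrow>
     (\<exists>C \<epsilon>. graded_free_resolution_of_residue_field n C \<epsilon> \<and>
        graded_cycles C I i j \<noteq> graded_boundaries C I i j)"

text \<open>
  The supremum is taken in the extended reals, so that the zero ideal has regularity \<open>-\<infinity>\<close>; a finite
  supremum of a nonempty set of integers is its maximum.
\<close>

definition regularity :: "nat \<Rightarrow> ('k::field) mpoly set \<Rightarrow> ereal" where
  "regularity n I = Sup {ereal (real_of_int (j - int i)) | i j. Tor_nonzero n I i j}"

definition d_linear_resolution :: "nat \<Rightarrow> nat \<Rightarrow> ('k::field) mpoly set \<Rightarrow> bool" where
  "d_linear_resolution n d I \<longleftrightarrow>
     (\<forall>G. minimal_homogeneous_generating_set n I G \<longrightarrow> (\<forall>g\<in>G. homogeneous g (int d))) \<and>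
     regularity n I = ereal (real d)"

definition linear_resolution :: "nat \<Rightarrow> ('k::field) mpoly set \<Rightarrow> bool" where
  "linear_resolution n I \<longleftrightarrow> (\<exists>d. d_linear_resolution n d I)"

end

theory Submission imports Defs
begin

text \<open>
  For every \<open>s > 0\<close> there is a squarefree cubic ideal \<open>I\<close> with linear resolution, over any field and in
  \<open>n = 3s\<close> variables, whose gradient ideal has regularity \<open>s + 1\<close>; taking \<open>s = a + 2\<close> gives the theorem.
  Write \<open>a\<^sub>k, b\<^sub>k, z\<^sub>k\<close> (\<open>k < s\<close>) for the variables, with indices \<open>2k\<close>, \<open>2k + 1\<close> and \<open>2s + k\<close>. The
  generators of \<open>I\<close> are the monomials \<open>a\<^sub>k b\<^sub>k z\<^sub>k\<close> and all squarefree cubic monomials divisible by at least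
  two of the \<open>z\<^sub>k\<close>. The gradient ideal is then generated by the quadrics \<open>a\<^sub>k b\<^sub>k\<close> and by all products of
  some \<open>z\<^sub>k\<close> with another variable (\<open>staircase_pairs_eq\<close>). Since all generators are squarefree, every
  coefficient occurring in a derivative of a generator is \<open>1\<close>, in every characteristic
  (\<open>equigenerated.gradient_ideal_eq\<close>).

  The cubics with two \<open>z\<close>'s connect the otherwise unrelated monomials \<open>a\<^sub>k b\<^sub>k z\<^sub>k\<close>, which makes the
  resolution of \<open>I\<close> linear. Their derivatives, on the other hand, do not interfere with the \<open>s\<close> quadrics
  \<open>a\<^sub>k b\<^sub>k\<close> in disjoint sets of variables, a complete intersection of regularity \<open>s + 1\<close>.

  All regularities come from one step: if \<open>J \<subseteq> J'\<close> are monomial ideals whose generators do not involve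
  the variables of a monomial \<open>u\<close>, then \<open>J \<inter> u J' = u J\<close>, and the long exact sequence of
  \<open>0 \<rightarrow> u J \<rightarrow> J \<oplus> u J' \<rightarrow> J + u J' \<rightarrow> 0\<close> bounds the regularity of \<open>J + u J'\<close> by those of \<open>J\<close> and
  \<open>J'\<close>. Above the regularities of \<open>J\<close> and \<open>u J'\<close> the connecting homomorphism maps onto
  \<open>Tor(K, u J)\<close>, so that the bound is attained if it is attained for \<open>J\<close>
  (\<open>reg_le_Un_multiples\<close>). The ideals above are built from zero and the unit ideal by such steps,
  adjoining one variable or one product \<open>a\<^sub>k b\<^sub>k\<close> at a time.

  The homology of \<open>P \<otimes> I\<close> is handled on the level of cycles and boundaries, for an arbitrary graded free
  resolution \<open>P\<close> of the residue field, so that resolutions need not be compared with each other. Regularity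
  bounds hold for all \<open>P\<close>; for the value to be attained one resolution has to exist, and this is the
  Koszul complex, an iterated mapping cone (\<open>resolution_of_residue_field_exists\<close>).
\<close>

section \<open>Polynomials with prescribed support\<close>

definition mons :: "nat \<Rightarrow> (nat \<Rightarrow>\<^sub>0 nat) set" where
  "mons n = {m. Poly_Mapping.keys m \<subseteq> {..<n}}"

text \<open>
  A monomial ideal consists of the polynomials supported on an upward closed set of exponents, and a
  graded piece of the polynomials supported on one degree. In this form sums, intersections and monomial
  multiples of monomial ideals are unions, intersections and translates of sets of exponents.
\<close>

definition supported :: "(nat \<Rightarrow>\<^sub>0 nat) set \<Rightarrow> ('k::field) mpoly set" where
  "supported T = {p. Poly_Mapping.keys p \<subseteq> T}"

definition restr :: "(nat \<Rightarrow>\<^sub>0 nat) set \<Rightarrow> ('k::field) mpoly \<Rightarrow> 'k mpoly" where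
  "restr T p = Poly_Mapping.mapp (\<lambda>m c. c when m \<in> T) p"

definition of_degree :: "int \<Rightarrow> (nat \<Rightarrow>\<^sub>0 nat) set" where
  "of_degree e = {m. int (mono_deg m) = e}"

definition upclosed :: "nat \<Rightarrow> (nat \<Rightarrow>\<^sub>0 nat) set \<Rightarrow> bool" where
  "upclosed n T \<longleftrightarrow> T \<subseteq> mons n \<and> (\<forall>l\<in>mons n. \<forall>m\<in>T. l + m \<in> T)"

lemma keys_add_nat: "Poly_Mapping.keys (m + l) = Poly_Mapping.keys m \<union> Poly_Mapping.keys (l :: nat \<Rightarrow>\<^sub>0 nat)"
  by (auto simp: in_keys_iff lookup_add)

lemma mono_deg_add [simp]: "mono_deg (m + l) = mono_deg m + mono_deg l"
  unfolding mono_deg_def by (rule setsum_keys_plus_distrib) auto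

lemma mono_deg_single [simp]: "mono_deg (Poly_Mapping.single i k) = k"
  by (simp add: mono_deg_def)

lemma mono_deg_0 [simp]: "mono_deg 0 = 0"
  by (simp add: mono_deg_def)

lemma mono_deg_eq_0_iff [simp]: "mono_deg m = 0 \<longleftrightarrow> m = 0"
proof
  assume "mono_deg m = 0"
  then have "\<forall>i\<in>Poly_Mapping.keys m. Poly_Mapping.lookup m i = 0"
    by (simp add: mono_deg_def)
  then show "m = 0" by (metis in_keys_iff keys_eq_empty equals0I)
qed simp

lemma mons_add [simp]: "m + l \<in> mons n \<longleftrightarrow> m \<in> mons n \<and> l \<in> mons n"
  by (auto simp: mons_def keys_add_nat)

lemma mons_0 [simp]: "0 \<in> mons n"
  by (simp add: mons_def)

lemma mons_single [simp]: "i < n \<Longrightarrow> Poly_Mapping.single i k \<in> mons n"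
  by (auto simp: mons_def)

lemma carrier_polyring: "carrier (polyring n) = supported (mons n)"
  by (auto simp: polyring_def supported_def mons_def)

lemma homogeneous_iff: "homogeneous p e \<longleftrightarrow> p \<in> supported (of_degree e)"
  by (auto simp: homogeneous_def supported_def of_degree_def)

lemma supported_Int: "supported (T \<inter> U) = supported T \<inter> supported U"
  by (auto simp: supported_def)

lemma supported_mono: "T \<subseteq> U \<Longrightarrow> supported T \<subseteq> supported U"
  by (auto simp: supported_def)

lemma supported_0 [simp]: "0 \<in> supported T"
  by (simp add: supported_def)

lemma supported_add: "p \<in> supported T \<Longrightarrow> q \<in> supported T \<Longrightarrow> p + q \<in> supported T"
  unfolding supported_def using keys_add[of p q] by blast

lemma keys_uminus_mpoly: "Poly_Mapping.keys (- p :: ('k::field) mpoly) = Poly_Mapping.keys p"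
  by (auto simp: in_keys_iff)

lemma supported_uminus: "- p \<in> supported T \<longleftrightarrow> p \<in> supported T"
  by (simp add: supported_def keys_uminus_mpoly)

lemma supported_diff: "p \<in> supported T \<Longrightarrow> q \<in> supported T \<Longrightarrow> p - q \<in> supported T"
  using supported_add[of p T "- q"] by (simp add: supported_uminus)

lemma supported_sum: "(\<And>x. x \<in> X \<Longrightarrow> f x \<in> supported T) \<Longrightarrow> sum f X \<in> supported T"
  by (induction X rule: infinite_finite_induct) (auto intro: supported_add)

lemma supported_mult:
  assumes "p \<in> supported T" "q \<in> supported U" "\<And>m l. m \<in> T \<Longrightarrow> l \<in> U \<Longrightarrow> m + l \<in> W"
  shows "p * q \<in> supported W"
  using assms keys_mult[of p q] unfolding supported_def by fastforce

lemma supported_mult_upclosed: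
  "upclosed n T \<Longrightarrow> p \<in> supported (mons n) \<Longrightarrow> q \<in> supported T \<Longrightarrow> p * q \<in> supported T"
  by (rule supported_mult) (auto simp: upclosed_def)

lemma supported_mult_degree:
  "p \<in> supported (of_degree d) \<Longrightarrow> q \<in> supported (of_degree e) \<Longrightarrow> p * q \<in> supported (of_degree (d + e))"
  by (rule supported_mult) (auto simp: of_degree_def)

lemma lookup_restr: "Poly_Mapping.lookup (restr T p) m = (Poly_Mapping.lookup p m when m \<in> T)"
  by (auto simp: restr_def lookup_mapp when_def in_keys_iff)

lemma restr_add: "restr T (p + q) = restr T p + restr T q"
  by (rule poly_mapping_eqI) (simp add: lookup_restr lookup_add when_def)

lemma restr_0 [simp]: "restr T 0 = 0"
  by (rule poly_mapping_eqI) (simp add: lookup_restr)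

lemma restr_sum: "restr T (sum f X) = (\<Sum>x\<in>X. restr T (f x))"
  by (induction X rule: infinite_finite_induct) (auto simp: restr_add)

lemma restr_supported: "restr T p \<in> supported T"
  by (auto simp: supported_def in_keys_iff lookup_restr)

lemma restr_supported': "p \<in> supported U \<Longrightarrow> restr T p \<in> supported U"
  by (auto simp: supported_def in_keys_iff lookup_restr)

lemma diff_restr_supported: "p \<in> supported (T \<union> U) \<Longrightarrow> p - restr T p \<in> supported U"
  by (auto simp: supported_def in_keys_iff lookup_restr lookup_minus when_def split: if_splits)

lemma restr_id: "p \<in> supported T \<Longrightarrow> restr T p = p"
  by (rule poly_mapping_eqI) (auto simp: supported_def lookup_restr when_def in_keys_iff)

lemma restr_eq_0: "p \<in> supported U \<Longrightarrow> U \<inter> T = {} \<Longrightarrow> restr T p = 0"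
  by (rule poly_mapping_eqI) (auto simp: supported_def lookup_restr when_def in_keys_iff)

lemma supported_UNIV [simp]: "supported UNIV = UNIV"
  by (simp add: supported_def)

text \<open>
  Multiplication by a homogeneous polynomial only shifts the grading, so it commutes with taking
  homogeneous components.
\<close>

lemma restr_degree_mult:
  assumes "p \<in> supported (of_degree d)"
  shows "restr (of_degree (d + e)) (p * q) = p * restr (of_degree e) q"
proof -
  let ?r = "q - restr (of_degree e) q"
  have "?r \<in> supported (- of_degree e)"
    by (rule diff_restr_supported) (simp add: Compl_partition)
  then have "p * ?r \<in> supported (- of_degree (d + e))"
    by (rule supported_mult[OF assms]) (auto simp: of_degree_def)
  then have 1: "restr (of_degree (d + e)) (p * ?r) = 0"
    by (rule restr_eq_0) auto
  have "p * q = p * restr (of_degree e) q + p * ?r"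
    by (simp add: algebra_simps)
  then have "restr (of_degree (d + e)) (p * q) = restr (of_degree (d + e)) (p * restr (of_degree e) q)"
    by (simp add: restr_add 1)
  also have "\<dots> = p * restr (of_degree e) q"
    by (intro restr_id supported_mult_degree assms restr_supported)
  finally show ?thesis .
qed

lemma supported_monomial [simp]: "monomial m \<in> supported T \<longleftrightarrow> m \<in> T"
  by (simp add: supported_def monomial_def)

lemma monomial_neq_0 [simp]: "monomial m \<noteq> 0"
  by (metis keys_zero keys_single monomial_def one_neq_zero insert_not_empty)

lemma sum_singles: "(\<Sum>m\<in>Poly_Mapping.keys p. Poly_Mapping.single m (Poly_Mapping.lookup p m)) = p"
proof (rule poly_mapping_eqI)
  fix k
  have "(\<Sum>m\<in>Poly_Mapping.keys p. Poly_Mapping.lookup (Poly_Mapping.single m (Poly_Mapping.lookup p m)) k)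
     = (\<Sum>m\<in>Poly_Mapping.keys p. if m = k then Poly_Mapping.lookup p m else 0)"
    by (intro sum.cong) (auto simp: lookup_single when_def)
  then show "Poly_Mapping.lookup (\<Sum>m\<in>Poly_Mapping.keys p. Poly_Mapping.single m (Poly_Mapping.lookup p m)) k
      = Poly_Mapping.lookup p k"
    by (simp add: lookup_sum in_keys_iff)
qed

text \<open>
  The part of \<open>p\<close> outside \<open>T\<close> is moved outside the translate of \<open>T\<close>, and polynomials have no zero divisors.
\<close>

lemma supported_shift_iff:
  "monomial u * p \<in> supported ((+) u ` T) \<longleftrightarrow> p \<in> supported T" (is "?L \<longleftrightarrow> ?R")
proof
  assume ?R
  then show ?L by (intro supported_mult[of _ "{u}"]) auto
next
  assume L: ?L
  have "p = restr T p + (p - restr T p)" by simp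
  let ?r = "p - restr T p"
  have "?r \<in> supported (- T)"
    by (rule diff_restr_supported) (simp add: Compl_partition)
  then have 1: "monomial u * ?r \<in> supported (- ((+) u ` T))"
    by (intro supported_mult[of _ "{u}"]) auto
  have "monomial u * restr T p \<in> supported ((+) u ` T)"
    by (intro supported_mult[of _ "{u}" _ T] restr_supported) auto
  then have "monomial u * ?r \<in> supported ((+) u ` T)"
    using supported_diff[OF L] by (simp add: right_diff_distrib)
  with 1 have "monomial u * ?r \<in> supported (- ((+) u ` T) \<inter> (+) u ` T)"
    unfolding supported_Int by blast
  then have "monomial u * ?r = 0" by (simp add: supported_def)
  then have "?r = 0" by simp
  then show ?R using restr_supported[of T p] by simp
qed

lemma supported_shiftE:
  assumes "p \<in> supported ((+) u ` T)"
  obtains q where "p = monomial u * q" "q \<in> supported T"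
proof -
  define q where "q = (\<Sum>m\<in>Poly_Mapping.keys p. Poly_Mapping.single (m - u) (Poly_Mapping.lookup p m))"
  have "monomial u * q = (\<Sum>m\<in>Poly_Mapping.keys p. Poly_Mapping.single m (Poly_Mapping.lookup p m))"
    unfolding sum_distrib_left monomial_def mult_single q_def
    using assms by (intro sum.cong) (auto simp: supported_def)
  then have q: "monomial u * q = p" by (simp add: sum_singles)
  show ?thesis
  proof (rule that[OF q[symmetric]])
    show "q \<in> supported T" using assms unfolding q[symmetric] supported_shift_iff .
  qed
qed

lemma supported_degree_shift_iff:
  "monomial u * p \<in> supported (of_degree e) \<longleftrightarrow> p \<in> supported (of_degree (e - int (mono_deg u)))"
    (is "?L \<longleftrightarrow> ?R")
proof
  assume ?R
  then show ?L by (intro supported_mult[of _ "{u}"]) (auto simp: of_degree_def)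
next
  assume L: ?L
  have "monomial u * p \<in> supported ((+) u ` UNIV)"
    by (intro supported_mult[of _ "{u}" _ UNIV]) auto
  with L have "monomial u * p \<in> supported ((+) u ` UNIV \<inter> of_degree e)"
    by (simp add: supported_Int)
  also have "(+) u ` UNIV \<inter> of_degree e = (+) u ` of_degree (e - int (mono_deg u))"
    by (auto simp: of_degree_def)
  finally show ?R by (simp add: supported_shift_iff)
qed

lemma upclosed_mons [simp]: "upclosed n (mons n)"
  by (simp add: upclosed_def)

lemma upclosed_Un: "upclosed n T \<Longrightarrow> upclosed n U \<Longrightarrow> upclosed n (T \<union> U)"
  by (auto simp: upclosed_def)

lemma upclosed_Int: "upclosed n T \<Longrightarrow> upclosed n U \<Longrightarrow> upclosed n (T \<inter> U)"
  by (auto simp: upclosed_def)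

lemma upclosed_shift: "upclosed n T \<Longrightarrow> u \<in> mons n \<Longrightarrow> upclosed n ((+) u ` T)"
  unfolding upclosed_def by (auto simp: image_iff) (metis add.left_commute)

section \<open>Cycles and boundaries with coefficients in a monomial ideal\<close>

lemma boundary_add:
  "boundary C i (\<lambda>b. v b + w b) = (\<lambda>b. boundary C i v b + boundary C i w b)"
  by (auto simp: boundary_def fun_eq_iff algebra_simps sum.distrib)

lemma boundary_diff:
  "boundary C i (\<lambda>b. v b - w b) = (\<lambda>b. boundary C i v b - boundary C i w b)"
  by (auto simp: boundary_def fun_eq_iff algebra_simps sum_subtractf)

lemma boundary_mult:
  "boundary C i (\<lambda>b. p * v b) = (\<lambda>b. p * boundary C i v b)"
  by (auto simp: boundary_def fun_eq_iff algebra_simps sum_distrib_left)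

lemma chains_add: "v \<in> chains C (supported T) i \<Longrightarrow> w \<in> chains C (supported T) i \<Longrightarrow>
   (\<lambda>b. v b + w b) \<in> chains C (supported T) i"
  by (auto simp: chains_def intro: supported_add)

lemma graded_chains_add: "v \<in> graded_chains C (supported T) i j \<Longrightarrow> w \<in> graded_chains C (supported T) i j \<Longrightarrow>
   (\<lambda>b. v b + w b) \<in> graded_chains C (supported T) i j"
  by (auto simp: graded_chains_def chains_def homogeneous_iff intro: supported_add)

lemma graded_chains_diff: "v \<in> graded_chains C (supported T) i j \<Longrightarrow> w \<in> graded_chains C (supported T) i j \<Longrightarrow>
   (\<lambda>b. v b - w b) \<in> graded_chains C (supported T) i j"
  by (auto simp: graded_chains_def chains_def homogeneous_iff intro: supported_diff)

lemma graded_chains_mono: "T \<subseteq> U \<Longrightarrow> v \<in> graded_chains C (supported T) i j \<Longrightarrow> v \<in> graded_chains C (supported U) i j"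
  using supported_mono[of T U] by (fastforce simp: graded_chains_def chains_def)

lemma graded_chains_Int: "v \<in> graded_chains C (supported T) i j \<Longrightarrow> v \<in> graded_chains C (supported U) i j
  \<Longrightarrow> v \<in> graded_chains C (supported (T \<inter> U)) i j"
  by (auto simp: graded_chains_def chains_def supported_Int)

text \<open>
  Surjectivity of \<open>J \<oplus> J' \<rightarrow> J + J'\<close> on chains: send each term of a polynomial to an ideal which contains it.
\<close>

lemma graded_chains_split:
  assumes "v \<in> graded_chains C (supported (T \<union> U)) i j"
  obtains p q where "p \<in> graded_chains C (supported T) i j" "q \<in> graded_chains C (supported U) i j"
    "v = (\<lambda>b. p b + q b)"
proof
  show "(\<lambda>b. restr T (v b)) \<in> graded_chains C (supported T) i j"
    using assms by (auto simp: graded_chains_def chains_def homogeneous_iff intro: restr_supported restr_supported')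
  show "(\<lambda>b. v b - restr T (v b)) \<in> graded_chains C (supported U) i j"
    using assms by (auto simp: graded_chains_def chains_def homogeneous_iff
       intro: diff_restr_supported supported_diff[where T = "of_degree _", OF _ restr_supported'])
qed auto

lemma graded_chains_shift_iff:
  "(\<lambda>b. monomial u * v b) \<in> graded_chains C (supported ((+) u ` T)) i j \<longleftrightarrow>
     v \<in> graded_chains C (supported T) i (j - int (mono_deg u))"
proof -
  have *: "j - int (mono_deg u) - g = j - g - int (mono_deg u)" for g by simp
  show ?thesis unfolding *
    by (auto simp: graded_chains_def chains_def homogeneous_iff supported_shift_iff supported_degree_shift_iff *)
qed

lemma graded_chains_shiftE:
  assumes "v \<in> graded_chains C (supported ((+) u ` T)) i j"
  obtains w where "v = (\<lambda>b. monomial u * w b)" "w \<in> graded_chains C (supported T) i (j - int (mono_deg u))"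
proof -
  have "\<exists>q. v b = monomial u * q" for b
  proof (cases "b < rk C i")
    case True
    then have "v b \<in> supported ((+) u ` T)" using assms by (auto simp: graded_chains_def chains_def)
    then show ?thesis using supported_shiftE by metis
  next
    case False
    then have "v b = monomial u * 0" using assms by (auto simp: graded_chains_def chains_def)
    then show ?thesis by blast
  qed
  then have "\<forall>b. \<exists>q. v b = monomial u * q" by blast
  from choice[OF this] obtain w where "\<forall>b. v b = monomial u * w b" by blast
  then have w: "v = (\<lambda>b. monomial u * w b)" by blast
  show ?thesis using that[OF w] assms[unfolded w graded_chains_shift_iff] by blast
qed

text \<open>
  The sets \<open>T\<close> and \<open>U\<close> of exponents below stand for the monomial ideals \<open>J = supported T\<close> and \<open>J' = supported U\<close>.
\<close>

locale residue_field_resolution =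
  fixes n :: nat and C :: "('k::field) free_complex" and \<epsilon> :: "nat \<Rightarrow> 'k"
  assumes resolution: "graded_free_resolution_of_residue_field n C \<epsilon>"
begin

abbreviation "gchains T \<equiv> graded_chains C (supported T)"
abbreviation "gcycles T \<equiv> graded_cycles C (supported T)"
abbreviation "gboundaries T \<equiv> graded_boundaries C (supported T)"

lemma dmat_carrier: "b < rk C i \<Longrightarrow> c < rk C (Suc i) \<Longrightarrow> dmat C i b c \<in> supported (mons n)"
  using resolution by (auto simp: graded_free_resolution_of_residue_field_def carrier_polyring)

lemma dmat_degree: "b < rk C i \<Longrightarrow> c < rk C (Suc i) \<Longrightarrow>
   dmat C i b c \<in> supported (of_degree (gen_deg C (Suc i) c - gen_deg C i b))"
  using resolution by (auto simp: graded_free_resolution_of_residue_field_def homogeneous_iff)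

lemma boundary_gchains:
  assumes "upclosed n T" "v \<in> gchains T (Suc i) j"
  shows "boundary C i v \<in> gchains T i j"
proof -
  have "boundary C i v b \<in> supported T \<and> boundary C i v b \<in> supported (of_degree (j - gen_deg C i b))"
    if b: "b < rk C i" for b
  proof -
    have "dmat C i b c * v c \<in> supported T \<and> dmat C i b c * v c \<in> supported (of_degree (j - gen_deg C i b))"
      if "c < rk C (Suc i)" for c
    proof
      show "dmat C i b c * v c \<in> supported T"
        using assms that b by (intro supported_mult_upclosed[of n] dmat_carrier) (auto simp: graded_chains_def chains_def)
      have "v c \<in> supported (of_degree (j - gen_deg C (Suc i) c))"
        using assms that b by (auto simp: graded_chains_def homogeneous_iff)
      from supported_mult_degree[OF dmat_degree[OF b that] this]
      show "dmat C i b c * v c \<in> supported (of_degree (j - gen_deg C i b))" by simp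
    qed
    then show ?thesis using b by (auto simp: boundary_def intro!: supported_sum)
  qed
  then show ?thesis by (auto simp: graded_chains_def chains_def homogeneous_iff) (auto simp: boundary_def)
qed

lemma gchains_chains: "T \<subseteq> mons n \<Longrightarrow> v \<in> gchains T i j \<Longrightarrow> v \<in> chains C (supported (mons n)) i"
  using graded_chains_mono[of T "mons n" v C i j] by (auto simp: graded_chains_def)

lemma boundary_boundary:
  assumes "v \<in> chains C (supported (mons n)) (Suc (Suc i))"
  shows "boundary C i (boundary C (Suc i) v) = (\<lambda>_. 0)"
  using assms resolution unfolding graded_free_resolution_of_residue_field_def carrier_polyring by blast

lemma boundary_gcycles:
  assumes "upclosed n T" "v \<in> gchains T (Suc i) j"
  shows "boundary C i v \<in> gcycles T i j"
  using boundary_gchains[OF assms] boundary_boundary[OF gchains_chains] assms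
  by (auto simp: graded_cycles_def upclosed_def split: nat.split)

lemma gboundaries_subset: "upclosed n T \<Longrightarrow> gboundaries T i j \<subseteq> gcycles T i j"
  using boundary_gcycles by (auto simp: graded_boundaries_def)

text \<open>\<open>Tor\<^sub>i(K, J)\<^sub>j = 0\<close> for the ideal \<open>J\<close> of \<open>T\<close>, computed with the resolution \<open>C\<close>.\<close>

definition vanishes :: "(nat \<Rightarrow>\<^sub>0 nat) set \<Rightarrow> nat \<Rightarrow> int \<Rightarrow> bool" where
  "vanishes T i j \<longleftrightarrow> gcycles T i j = gboundaries T i j"

lemma vanishesI:
  assumes "upclosed n T" "\<And>v. v \<in> gcycles T i j \<Longrightarrow> \<exists>w \<in> gchains T (Suc i) j. v = boundary C i w"
  shows "vanishes T i j"
  using assms(2) gboundaries_subset[OF assms(1), of i j] unfolding vanishes_def graded_boundaries_def by blast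

lemma vanishesD:
  assumes "vanishes T i j" "v \<in> gcycles T i j"
  obtains w where "w \<in> gchains T (Suc i) j" "v = boundary C i w"
  using assms by (auto simp: vanishes_def graded_boundaries_def)

lemma gcycles_Suc: "v \<in> gcycles T (Suc i) j \<longleftrightarrow> v \<in> gchains T (Suc i) j \<and> boundary C i v = (\<lambda>_. 0)"
  by (simp add: graded_cycles_def)

lemma vanishes_shift_iff:
  assumes "upclosed n T" "u \<in> mons n"
  shows "vanishes ((+) u ` T) i j \<longleftrightarrow> vanishes T i (j - int (mono_deg u))"
proof
  assume L: "vanishes ((+) u ` T) i j"
  show "vanishes T i (j - int (mono_deg u))"
  proof (rule vanishesI[OF assms(1)])
    fix v assume "v \<in> gcycles T i (j - int (mono_deg u))"
    then have "(\<lambda>b. monomial u * v b) \<in> gcycles ((+) u ` T) i j"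
      by (auto simp: graded_cycles_def graded_chains_shift_iff boundary_mult split: nat.splits)
    from vanishesD[OF L this] obtain w where w: "w \<in> gchains ((+) u ` T) (Suc i) j"
      "(\<lambda>b. monomial u * v b) = boundary C i w" .
    from graded_chains_shiftE[OF w(1)] obtain w' where w':
      "w = (\<lambda>b. monomial u * w' b)" "w' \<in> gchains T (Suc i) (j - int (mono_deg u))" .
    have "v = boundary C i w'" using w(2) by (simp add: w'(1) boundary_mult fun_eq_iff)
    with w'(2) show "\<exists>w \<in> gchains T (Suc i) (j - int (mono_deg u)). v = boundary C i w" by blast
  qed
next
  assume R: "vanishes T i (j - int (mono_deg u))"
  show "vanishes ((+) u ` T) i j"
  proof (rule vanishesI[OF upclosed_shift[OF assms]])
    fix v assume v: "v \<in> gcycles ((+) u ` T) i j"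
    then have "v \<in> gchains ((+) u ` T) i j" by (simp add: graded_cycles_def)
    from graded_chains_shiftE[OF this] obtain v' where v':
      "v = (\<lambda>b. monomial u * v' b)" "v' \<in> gchains T i (j - int (mono_deg u))" .
    have "v' \<in> gcycles T i (j - int (mono_deg u))"
      using v v' by (auto simp: graded_cycles_def boundary_mult fun_eq_iff split: nat.splits)
    from vanishesD[OF R this] obtain w where w: "w \<in> gchains T (Suc i) (j - int (mono_deg u))"
      "v' = boundary C i w" .
    then show "\<exists>w \<in> gchains ((+) u ` T) (Suc i) j. v = boundary C i w"
      by (intro bexI[of _ "\<lambda>b. monomial u * w b"]) (auto simp: graded_chains_shift_iff boundary_mult v')
  qed
qed

text \<open>
  The portion \<open>Tor\<^sub>i(J) \<oplus> Tor\<^sub>i(J') \<rightarrow> Tor\<^sub>i(J + J') \<rightarrow> Tor\<^bsub>i-1\<^esub>(J \<inter> J')\<close> of the Mayer-Vietoris sequence: split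
  a cycle as \<open>p + q\<close>. The boundary of \<open>p\<close> is a cycle of the intersection, hence bounds some \<open>w\<close> there, and
  \<open>p - w\<close> and \<open>q + w\<close> are cycles of the two ideals.
\<close>

lemma vanishes_Un:
  assumes T: "upclosed n T" and U: "upclosed n U"
    and vT: "vanishes T i j" and vU: "vanishes U i j" and vI: "\<And>k. i = Suc k \<Longrightarrow> vanishes (T \<inter> U) k j"
  shows "vanishes (T \<union> U) i j"
proof (rule vanishesI[OF upclosed_Un[OF T U]])
  fix v assume v: "v \<in> gcycles (T \<union> U) i j"
  then have "v \<in> gchains (T \<union> U) i j" by (simp add: graded_cycles_def)
  from graded_chains_split[OF this] obtain p q where
    p: "p \<in> gchains T i j" and q: "q \<in> gchains U i j" and vpq: "v = (\<lambda>b. p b + q b)" .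
  have "\<exists>p' q'. p' \<in> gcycles T i j \<and> q' \<in> gcycles U i j \<and> v = (\<lambda>b. p' b + q' b)"
  proof (cases i)
    case 0
    then show ?thesis using p q vpq by (auto simp: graded_cycles_def)
  next
    case (Suc k)
    have eq: "boundary C k p b = - boundary C k q b" for b
    proof -
      have "boundary C k v b = 0" using v Suc by (simp add: gcycles_Suc)
      then show ?thesis unfolding vpq boundary_add by (simp add: eq_neg_iff_add_eq_0)
    qed
    have 1: "boundary C k p \<in> gcycles T k j" "boundary C k q \<in> gchains U k j"
      using boundary_gcycles[OF T] boundary_gchains[OF U] p q Suc by auto
    have "boundary C k p \<in> gchains U k j"
      using 1(2) unfolding graded_chains_def chains_def homogeneous_iff by (simp add: eq supported_uminus)
    with 1(1) have "boundary C k p \<in> gcycles (T \<inter> U) k j"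
      by (auto simp: graded_cycles_def intro: graded_chains_Int)
    from vanishesD[OF vI[OF Suc] this] obtain w where w: "w \<in> gchains (T \<inter> U) (Suc k) j"
      "boundary C k p = boundary C k w" .
    have wT: "w \<in> gchains T i j" and wU: "w \<in> gchains U i j"
      using graded_chains_mono[OF _ w(1)] Suc by auto
    have "(\<lambda>b. p b - w b) \<in> gcycles T i j"
      using p wT w(2) Suc graded_chains_diff by (auto simp: gcycles_Suc boundary_diff)
    moreover have "(\<lambda>b. q b + w b) \<in> gcycles U i j"
      using q wU w(2)[symmetric] Suc graded_chains_add by (auto simp: gcycles_Suc boundary_add eq)
    ultimately show ?thesis
      by (intro exI[of _ "\<lambda>b. p b - w b"] exI[of _ "\<lambda>b. q b + w b"]) (simp add: vpq)
  qed
  then obtain p' q' where p': "p' \<in> gcycles T i j" and q': "q' \<in> gcycles U i j" and v': "v = (\<lambda>b. p' b + q' b)"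
    by blast
  obtain a where a: "a \<in> gchains T (Suc i) j" "p' = boundary C i a" using vanishesD[OF vT p'] .
  obtain c where c: "c \<in> gchains U (Suc i) j" "q' = boundary C i c" using vanishesD[OF vU q'] .
  show "\<exists>w \<in> gchains (T \<union> U) (Suc i) j. v = boundary C i w"
    by (intro bexI[of _ "\<lambda>b. a b + c b"] graded_chains_add)
       (auto simp: boundary_add v' a c intro: graded_chains_mono[OF _ a(1)] graded_chains_mono[OF _ c(1)])
qed

text \<open>
  The portion \<open>Tor\<^bsub>i+1\<^esub>(J + J') \<rightarrow> Tor\<^sub>i(J \<inter> J') \<rightarrow> Tor\<^sub>i(J) \<oplus> Tor\<^sub>i(J')\<close> of the same sequence: a cycle of the
  intersection bounds some \<open>p\<close> in \<open>J\<close> and some \<open>q\<close> in \<open>J'\<close>. The cycle \<open>p - q\<close> is the boundary of some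
  \<open>x + y\<close>, and \<open>p\<close> minus the boundary of \<open>x\<close> lies in both ideals.
\<close>

lemma vanishes_Int:
  assumes T: "upclosed n T" and U: "upclosed n U"
    and vT: "vanishes T i j" and vU: "vanishes U i j" and vUn: "vanishes (T \<union> U) (Suc i) j"
  shows "vanishes (T \<inter> U) i j"
proof (rule vanishesI[OF upclosed_Int[OF T U]])
  fix v assume v: "v \<in> gcycles (T \<inter> U) i j"
  then have "v \<in> gcycles T i j" "v \<in> gcycles U i j"
    using graded_chains_mono[of "T \<inter> U" _ v C i j] by (auto simp: graded_cycles_def)
  obtain p where p: "p \<in> gchains T (Suc i) j" "v = boundary C i p" using vanishesD[OF vT \<open>v \<in> gcycles T i j\<close>] .
  obtain q where q: "q \<in> gchains U (Suc i) j" "v = boundary C i q" using vanishesD[OF vU \<open>v \<in> gcycles U i j\<close>] .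
  have "(\<lambda>b. p b - q b) \<in> gcycles (T \<union> U) (Suc i) j"
    unfolding gcycles_Suc boundary_diff p(2)[symmetric] q(2)[symmetric]
    by (auto intro!: graded_chains_diff graded_chains_mono[OF _ p(1)] graded_chains_mono[OF _ q(1)])
  from vanishesD[OF vUn this] obtain w where w: "w \<in> gchains (T \<union> U) (Suc (Suc i)) j"
    "(\<lambda>b. p b - q b) = boundary C (Suc i) w" .
  from graded_chains_split[OF w(1)] obtain x y where
    x: "x \<in> gchains T (Suc (Suc i)) j" and y: "y \<in> gchains U (Suc (Suc i)) j" and wxy: "w = (\<lambda>b. x b + y b)" .
  let ?c = "\<lambda>b. p b - boundary C (Suc i) x b"
  have c': "?c = (\<lambda>b. q b + boundary C (Suc i) y b)"
    using w(2) unfolding wxy boundary_add by (simp add: fun_eq_iff algebra_simps)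
  have "?c \<in> gchains T (Suc i) j" by (intro graded_chains_diff p boundary_gchains[OF T] x)
  moreover have "?c \<in> gchains U (Suc i) j" unfolding c' by (intro graded_chains_add q boundary_gchains[OF U] y)
  ultimately have "?c \<in> gchains (T \<inter> U) (Suc i) j" by (rule graded_chains_Int)
  moreover have "v = boundary C i ?c"
    using boundary_boundary[OF gchains_chains[OF _ x]] T by (simp add: boundary_diff p(2) upclosed_def)
  ultimately show "\<exists>w \<in> gchains (T \<inter> U) (Suc i) j. v = boundary C i w" by blast
qed

end

section \<open>Squarefree monomial ideals\<close>

text \<open>
  Membership of a monomial in a squarefree monomial ideal depends only on its support. Such an ideal is
  given by a family \<open>F\<close> of sets of variables that is closed under supersets. Its minimal generators do not
  involve the variables in \<open>U\<close> if and only if \<open>F\<close> is closed under removing \<open>U\<close>.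
\<close>

definition upward :: "nat set set \<Rightarrow> bool" where
  "upward F \<longleftrightarrow> (\<forall>X\<in>F. \<forall>Y. X \<subseteq> Y \<longrightarrow> Y \<in> F)"

definition ignores :: "nat set set \<Rightarrow> nat set \<Rightarrow> bool" where
  "ignores F U \<longleftrightarrow> (\<forall>X\<in>F. X - U \<in> F)"

definition sqfree :: "nat \<Rightarrow> nat set set \<Rightarrow> (nat \<Rightarrow>\<^sub>0 nat) set" where
  "sqfree n F = {m \<in> mons n. Poly_Mapping.keys m \<in> F}"

definition var_prod :: "nat set \<Rightarrow> (nat \<Rightarrow>\<^sub>0 nat)" where
  "var_prod U = (\<Sum>i\<in>U. Poly_Mapping.single i 1)"

lemma lookup_var_prod: "finite U \<Longrightarrow> Poly_Mapping.lookup (var_prod U) i = (if i \<in> U then 1 else 0)"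
  by (simp add: var_prod_def lookup_sum lookup_single when_def)

lemma keys_var_prod [simp]: "finite U \<Longrightarrow> Poly_Mapping.keys (var_prod U) = U"
  by (auto simp: in_keys_iff lookup_var_prod split: if_splits)

lemma mono_deg_var_prod [simp]: "finite U \<Longrightarrow> mono_deg (var_prod U) = card U"
  by (simp add: mono_deg_def lookup_var_prod)

lemma var_prod_mons: "U \<subseteq> {..<n} \<Longrightarrow> var_prod U \<in> mons n"
  using finite_subset[of U "{..<n}"] by (simp add: mons_def)

lemma var_prod_divides:
  assumes "finite U" "U \<subseteq> Poly_Mapping.keys m"
  shows "m = (m - var_prod U) + var_prod U"
proof (rule poly_mapping_eqI)
  fix i
  have "Poly_Mapping.lookup (var_prod U) i \<le> Poly_Mapping.lookup m i"
    using assms by (auto simp: lookup_var_prod in_keys_iff Suc_le_eq)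
  then show "Poly_Mapping.lookup m i = Poly_Mapping.lookup ((m - var_prod U) + var_prod U) i"
    by (simp add: lookup_add lookup_minus)
qed

lemma upwardD: "upward F \<Longrightarrow> X \<in> F \<Longrightarrow> X \<subseteq> Y \<Longrightarrow> Y \<in> F"
  by (auto simp: upward_def)

lemma upclosed_sqfree: "upward F \<Longrightarrow> upclosed n (sqfree n F)"
  by (auto simp: upclosed_def sqfree_def keys_add_nat intro: upwardD)

lemma sqfree_UNIV [simp]: "sqfree n UNIV = mons n"
  by (simp add: sqfree_def)

lemma sqfree_empty [simp]: "sqfree n {} = {}"
  by (simp add: sqfree_def)

text \<open>
  Let \<open>J\<close> and \<open>J'\<close> be the ideals of \<open>F\<close> and \<open>G\<close>, and let \<open>u\<close> be the product of the variables in \<open>U\<close>, none of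
  which occurs in the generators of \<open>J\<close> and \<open>J'\<close>. Then \<open>J + u J'\<close> is again squarefree, and division by
  \<open>u\<close> does not affect membership in \<open>J\<close>, so that \<open>J \<inter> u J' = u J\<close> if \<open>J \<subseteq> J'\<close>.
\<close>

context
  fixes n :: nat and F G :: "nat set set" and U :: "nat set"
  assumes F: "upward F" "ignores F U" and G: "upward G" "ignores G U"
    and U: "U \<subseteq> {..<n}"
begin

lemma sqfree_Un_multiples:
  "sqfree n (F \<union> {X. U \<subseteq> X \<and> X \<in> G}) = sqfree n F \<union> (+) (var_prod U) ` sqfree n G" (is "?L = ?R")
proof (intro equalityI subsetI)
  note finU = finite_subset[OF U finite_lessThan]
  fix m assume m: "m \<in> ?L"
  show "m \<in> ?R"
  proof (cases "Poly_Mapping.keys m \<in> F")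
    case True
    then show ?thesis using m by (auto simp: sqfree_def)
  next
    case False
    then have UG: "U \<subseteq> Poly_Mapping.keys m" "Poly_Mapping.keys m \<in> G" using m by (auto simp: sqfree_def)
    let ?l = "m - var_prod U"
    have eq: "m = var_prod U + ?l"
      using var_prod_divides[OF finU UG(1)] by (simp only: add.commute)
    have "Poly_Mapping.keys m - U \<subseteq> Poly_Mapping.keys ?l"
      using finU by (auto simp: in_keys_iff lookup_minus lookup_var_prod)
    then have "Poly_Mapping.keys ?l \<in> G"
      using upwardD[OF G(1)] G(2) UG(2) unfolding ignores_def by blast
    moreover have "m \<in> mons n" using m by (simp add: sqfree_def)
    then have "var_prod U + ?l \<in> mons n" using eq by simp
    then have "?l \<in> mons n" by (simp only: mons_add)
    ultimately have "?l \<in> sqfree n G" by (simp add: sqfree_def)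
    then have "var_prod U + ?l \<in> (+) (var_prod U) ` sqfree n G" by (rule imageI)
    then show ?thesis using eq by simp
  qed
next
  note finU = finite_subset[OF U finite_lessThan]
  fix m assume "m \<in> ?R"
  then show "m \<in> ?L" using finU U
    by (auto simp: sqfree_def keys_add_nat mons_def intro: upwardD[OF G(1)])
qed

lemma sqfree_Int_multiples:
  assumes "F \<subseteq> G"
  shows "sqfree n F \<inter> (+) (var_prod U) ` sqfree n G = (+) (var_prod U) ` sqfree n F" (is "?L = ?R")
proof (intro equalityI subsetI)
  note finU = finite_subset[OF U finite_lessThan]
  fix m assume "m \<in> ?L"
  then obtain l where l: "m = var_prod U + l" "l \<in> mons n" "Poly_Mapping.keys m \<in> F"
    by (auto simp: sqfree_def)
  then have "Poly_Mapping.keys m - U \<subseteq> Poly_Mapping.keys l" using finU by (auto simp: keys_add_nat)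
  then have "l \<in> sqfree n F" using l upwardD[OF F(1)] F(2) by (auto simp: sqfree_def ignores_def)
  then show "m \<in> ?R" using l by simp
next
  note finU = finite_subset[OF U finite_lessThan]
  fix m assume "m \<in> ?R"
  then show "m \<in> ?L" using finU U assms
    by (auto simp: sqfree_def keys_add_nat mons_def intro: upwardD[OF F(1)])
qed

end

section \<open>Bounds for the regularity and their attainment\<close>

context residue_field_resolution
begin

text \<open>
  The regularity of the ideal of \<open>T\<close> is \<open>r\<close> if and only if both \<open>reg_le T r\<close> and \<open>attains T r\<close> hold. The two
  parts are kept apart because the zero ideal satisfies the first one for every \<open>r\<close>.
\<close>

definition reg_le :: "(nat \<Rightarrow>\<^sub>0 nat) set \<Rightarrow> int \<Rightarrow> bool" where
  "reg_le T r \<longleftrightarrow> (\<forall>i j. r < j - int i \<longrightarrow> vanishes T i j)"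

definition attains :: "(nat \<Rightarrow>\<^sub>0 nat) set \<Rightarrow> int \<Rightarrow> bool" where
  "attains T r \<longleftrightarrow> (\<exists>i j. j - int i = r \<and> \<not> vanishes T i j)"

lemma reg_le_mono: "reg_le T r \<Longrightarrow> r \<le> r' \<Longrightarrow> reg_le T r'"
  by (auto simp: reg_le_def)

lemma reg_le_empty: "reg_le {} r"
  unfolding reg_le_def
proof (intro allI impI vanishesI)
  fix i j v assume "v \<in> gcycles {} i j"
  then have "v \<in> gchains {} i j" by (simp add: graded_cycles_def)
  then have "v b = 0" for b
    by (cases "b < rk C i") (auto simp: graded_chains_def chains_def supported_def)
  then have "v = boundary C i (\<lambda>_. 0)" by (auto simp: boundary_def)
  then show "\<exists>w\<in>gchains {} (Suc i) j. v = boundary C i w"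
    by (intro bexI[of _ "\<lambda>_. 0"]) (auto simp: graded_chains_def chains_def homogeneous_iff)
qed (simp add: upclosed_def)

text \<open>
  Exactness of a resolution is an ungraded condition. It implies exactness in each degree, as the
  components of the right degrees of a preimage form a preimage.
\<close>

lemma boundary_homogeneous_preimage:
  assumes v: "v \<in> gchains (mons n) i j" and w: "w \<in> chains C (supported (mons n)) (Suc i)" "v = boundary C i w"
  shows "\<exists>w'\<in>gchains (mons n) (Suc i) j. v = boundary C i w'"
proof (rule bexI)
  let ?w = "\<lambda>c. if c < rk C (Suc i) then restr (of_degree (j - gen_deg C (Suc i) c)) (w c) else 0"
  show "?w \<in> gchains (mons n) (Suc i) j"
    using w by (auto simp: graded_chains_def chains_def homogeneous_iff intro: restr_supported restr_supported')
  show "v = boundary C i ?w"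
  proof
    fix b
    show "v b = boundary C i ?w b"
    proof (cases "b < rk C i")
      case True
      have "v b = restr (of_degree (j - gen_deg C i b)) (v b)"
        using v True by (intro restr_id[symmetric]) (auto simp: graded_chains_def homogeneous_iff)
      also have "\<dots> = (\<Sum>c<rk C (Suc i). restr (of_degree (j - gen_deg C i b)) (dmat C i b c * w c))"
        using True by (simp add: w(2) boundary_def restr_sum)
      also have "\<dots> = (\<Sum>c<rk C (Suc i). dmat C i b c * ?w c)"
      proof (rule sum.cong)
        fix c assume "c \<in> {..<rk C (Suc i)}"
        then show "restr (of_degree (j - gen_deg C i b)) (dmat C i b c * w c) = dmat C i b c * ?w c"
          using restr_degree_mult[OF dmat_degree[OF True], of c "j - gen_deg C (Suc i) c" "w c"]
          by simp
      qed simp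
      finally show ?thesis using True by (simp add: boundary_def)
    qed (simp add: w(2) boundary_def)
  qed
qed

lemma augmentation_positive_degree:
  assumes "v \<in> gchains T 0 j" "j \<noteq> 0"
  shows "augmentation C \<epsilon> v = 0"
  unfolding augmentation_def
proof (rule sum.neutral, rule ballI)
  fix b assume "b \<in> {..<rk C 0}"
  then have b: "b < rk C 0" by simp
  show "Poly_Mapping.lookup (v b) 0 * \<epsilon> b = 0"
  proof (cases "\<epsilon> b = 0")
    case False
    then have "gen_deg C 0 b = 0"
      using resolution b by (auto simp: graded_free_resolution_of_residue_field_def)
    then have "v b \<in> supported (of_degree j)" using assms b by (force simp: graded_chains_def homogeneous_iff)
    then have "0 \<notin> Poly_Mapping.keys (v b)" using assms(2) by (auto simp: supported_def of_degree_def)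
    then show ?thesis by (simp add: in_keys_iff)
  qed simp
qed

lemma augmentation_boundary:
  assumes "v \<in> chains C (supported (mons n)) (Suc 0)"
  shows "augmentation C \<epsilon> (boundary C 0 v) = 0"
  using assms resolution unfolding graded_free_resolution_of_residue_field_def carrier_polyring by force

lemma reg_le_mons: "reg_le (mons n) 0"
  unfolding reg_le_def
proof (intro allI impI vanishesI upclosed_mons)
  fix i j v assume j: "0 < j - int i" and v: "v \<in> gcycles (mons n) i j"
  then have g: "v \<in> gchains (mons n) i j" by (simp add: graded_cycles_def)
  have "\<exists>w \<in> chains C (supported (mons n)) (Suc i). v = boundary C i w"
  proof (cases i)
    case 0
    have "v \<in> {v \<in> chains C (carrier (polyring n)) 0. augmentation C \<epsilon> v = 0}"
      using g augmentation_positive_degree[of v "mons n" j] j 0 by (auto simp: carrier_polyring graded_chains_def)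
    also have "\<dots> = boundary C 0 ` chains C (carrier (polyring n)) 1"
      using resolution by (simp add: graded_free_resolution_of_residue_field_def)
    finally show ?thesis using 0 by (auto simp: carrier_polyring)
  next
    case (Suc k)
    have "v \<in> {v \<in> chains C (carrier (polyring n)) (Suc k). boundary C k v = (\<lambda>_. 0)}"
      using v Suc by (auto simp: carrier_polyring graded_cycles_def graded_chains_def)
    also have "\<dots> = boundary C (Suc k) ` chains C (carrier (polyring n)) (Suc (Suc k))"
      using resolution by (simp add: graded_free_resolution_of_residue_field_def)
    finally show ?thesis using Suc by (auto simp: carrier_polyring)
  qed
  then show "\<exists>w\<in>gchains (mons n) (Suc i) j. v = boundary C i w"
    using boundary_homogeneous_preimage[OF g] by blast
qed

lemma reg_le_shift:
  "upclosed n T \<Longrightarrow> u \<in> mons n \<Longrightarrow> reg_le T r \<Longrightarrow> reg_le ((+) u ` T) (r + int (mono_deg u))"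
  by (auto simp: reg_le_def vanishes_shift_iff)

lemma attains_shift:
  assumes "upclosed n T" "u \<in> mons n" "attains T r"
  shows "attains ((+) u ` T) (r + int (mono_deg u))"
proof -
  obtain i j where "j - int i = r" "\<not> vanishes T i j" using assms(3) by (auto simp: attains_def)
  then show ?thesis unfolding attains_def
    by (intro exI[of _ i] exI[of _ "j + int (mono_deg u)"]) (simp add: vanishes_shift_iff assms)
qed

lemma reg_le_Un:
  assumes "upclosed n T" "upclosed n U" "reg_le T r" "reg_le U r" "reg_le (T \<inter> U) (r + 1)"
  shows "reg_le (T \<union> U) r"
  using assms unfolding reg_le_def by (intro allI impI vanishes_Un) auto

text \<open>
  A nonzero class of \<open>Tor\<^sub>i\<close> of the intersection lying above the regularities of both ideals is killed in
  their direct sum, so it comes from \<open>Tor\<^bsub>i+1\<^esub>\<close> of the sum of the ideals.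
\<close>

lemma attains_Un:
  assumes "upclosed n T" "upclosed n U" "reg_le T r" "reg_le U r" "attains (T \<inter> U) (r + 1)"
  shows "attains (T \<union> U) r"
proof -
  obtain i j where ij: "j - int i = r + 1" "\<not> vanishes (T \<inter> U) i j" using assms(5) by (auto simp: attains_def)
  then have "vanishes T i j" "vanishes U i j" using assms(3,4) by (auto simp: reg_le_def)
  then have "\<not> vanishes (T \<union> U) (Suc i) j" using vanishes_Int[OF assms(1,2)] ij by blast
  then show ?thesis using ij unfolding attains_def by (intro exI[of _ "Suc i"] exI[of _ j]) auto
qed

text \<open>
  An element of least degree of an ideal \<open>J\<close> is a minimal generator, so it survives in \<open>J \<otimes> K\<close>. As \<open>C\<close>
  need not be minimal, its matrices may have entries with constant terms. But the augmentation kills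
  boundaries, hence the \<open>\<epsilon>\<close>-weighted column sums \<open>g c\<close> of the first matrix have no constant term. The
  weighted sum of the entries of a boundary over \<open>J\<close> is a combination of the \<open>g c\<close> with coefficients in
  \<open>J\<close>, so it starts in a degree higher than that of the generator.
\<close>

lemma attains_initial_degree:
  assumes T: "upclosed n T" and u: "u \<in> T" and min: "\<And>m. m \<in> T \<Longrightarrow> mono_deg u \<le> mono_deg m"
  shows "attains T (int (mono_deg u))"
proof -
  obtain b0 where b0: "b0 < rk C 0" "\<epsilon> b0 \<noteq> 0"
    using resolution by (auto simp: graded_free_resolution_of_residue_field_def)
  then have deg0: "gen_deg C 0 b0 = 0"
    using resolution by (auto simp: graded_free_resolution_of_residue_field_def)
  define v :: "nat \<Rightarrow> 'k mpoly" where "v b = (if b = b0 then monomial u else 0)" for b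
  have v: "v \<in> gcycles T 0 (int (mono_deg u))"
    using b0 deg0 u by (auto simp: v_def graded_cycles_def graded_chains_def chains_def homogeneous_iff of_degree_def)
  have "\<not> vanishes T 0 (int (mono_deg u))"
  proof
    assume "vanishes T 0 (int (mono_deg u))"
    from vanishesD[OF this v] obtain w where w: "w \<in> gchains T (Suc 0) (int (mono_deg u))" "v = boundary C 0 w" .
    define g where "g c = (\<Sum>b<rk C 0. dmat C 0 b c * Poly_Mapping.single 0 (\<epsilon> b))" for c
    have lookup_scal: "Poly_Mapping.lookup (p * Poly_Mapping.single 0 x) 0 = Poly_Mapping.lookup p 0 * x" for p :: "'k mpoly" and x
    proof -
      have "p = Poly_Mapping.single 0 (Poly_Mapping.lookup p 0) + (p - Poly_Mapping.single 0 (Poly_Mapping.lookup p 0))"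
        (is "_ = _ + ?r") by simp
      have "?r \<in> supported (- {0})"
        by (auto simp: supported_def in_keys_iff lookup_minus)
      then have "?r * Poly_Mapping.single 0 x \<in> supported (- {0})"
        by (rule supported_mult[where U = "{0}"]) (auto simp: supported_def)
      then have "Poly_Mapping.lookup (?r * Poly_Mapping.single 0 x) 0 = 0" by (auto simp: supported_def in_keys_iff)
      moreover have "p * Poly_Mapping.single 0 x = Poly_Mapping.single 0 (Poly_Mapping.lookup p 0 * x) + ?r * Poly_Mapping.single 0 x"
        by (simp add: left_diff_distrib mult_single)
      ultimately show ?thesis by (simp add: lookup_add)
    qed
    have g: "g c \<in> supported (- {0})" if c: "c < rk C (Suc 0)" for c
    proof -
      let ?e = "\<lambda>c'. if c' = c then 1 else 0"
      have "(?e :: nat \<Rightarrow> 'k mpoly) \<in> chains C (supported (mons n)) (Suc 0)"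
        using c by (auto simp: chains_def supported_def)
      from augmentation_boundary[OF this]
      have "(\<Sum>b<rk C 0. Poly_Mapping.lookup (dmat C 0 b c) 0 * \<epsilon> b) = 0"
        using c by (simp add: augmentation_def boundary_def if_distrib cong: if_cong)
      then have "Poly_Mapping.lookup (g c) 0 = 0"
        by (simp add: g_def lookup_sum lookup_scal)
      then show ?thesis by (auto simp: supported_def in_keys_iff)
    qed
    have "monomial u * Poly_Mapping.single 0 (\<epsilon> b0) = (\<Sum>b<rk C 0. v b * Poly_Mapping.single 0 (\<epsilon> b))"
      using b0(1) by (simp add: v_def if_distrib if_distribR cong: if_cong)
    also have "\<dots> = (\<Sum>b<rk C 0. \<Sum>c<rk C (Suc 0). dmat C 0 b c * w c * Poly_Mapping.single 0 (\<epsilon> b))"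
      by (simp add: w(2) boundary_def sum_distrib_right)
    also have "\<dots> = (\<Sum>c<rk C (Suc 0). \<Sum>b<rk C 0. dmat C 0 b c * w c * Poly_Mapping.single 0 (\<epsilon> b))"
      by (rule sum.swap)
    also have "\<dots> = (\<Sum>c<rk C (Suc 0). g c * w c)"
      by (simp add: g_def sum_distrib_right sum_distrib_left mult_ac)
    also have "\<dots> \<in> supported {m. mono_deg u < mono_deg m}"
    proof (rule supported_sum)
      fix c assume "c \<in> {..<rk C (Suc 0)}"
      then have c: "c < rk C (Suc 0)" by simp
      then have "w c \<in> supported T" using w by (auto simp: graded_chains_def chains_def)
      then show "g c * w c \<in> supported {m. mono_deg u < mono_deg m}"
      proof (rule supported_mult[OF g[OF c]])
        fix m l :: "nat \<Rightarrow>\<^sub>0 nat" assume "m \<in> - {0}" "l \<in> T"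
        then have "0 < mono_deg m" "mono_deg u \<le> mono_deg l"
          using min mono_deg_eq_0_iff[of m] by (auto simp only: neq0_conv[symmetric] Compl_iff singleton_iff)
        then show "m + l \<in> {m. mono_deg u < mono_deg m}" by simp
      qed
    qed
    finally show False using b0(2) by (simp add: monomial_def mult_single supported_def)
  qed
  then show ?thesis unfolding attains_def by (intro exI[of _ 0] exI[of _ "int (mono_deg u)"]) simp
qed

text \<open>
  The step by which all ideals below are built. Here \<open>u J'\<close> has regularity at most \<open>r\<close>, and
  \<open>J \<inter> u J' = u J\<close> has regularity at most \<open>r + 1\<close>, with equality if the bound for \<open>J\<close> is attained.
\<close>

lemma reg_le_Un_multiples:
  assumes F: "upward F" "ignores F U" and G: "upward G" "ignores G U"
    and U: "U \<subseteq> {..<n}" "U \<noteq> {}" and FG: "F \<subseteq> G"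
    and rF: "reg_le (sqfree n F) (r + 1 - int (card U))" and rG: "reg_le (sqfree n G) (r - int (card U))"
  shows "reg_le (sqfree n (F \<union> {X. U \<subseteq> X \<and> X \<in> G})) r"
    and "attains (sqfree n F) (r + 1 - int (card U)) \<Longrightarrow> attains (sqfree n (F \<union> {X. U \<subseteq> X \<and> X \<in> G})) r"
proof -
  have fin: "finite U" using finite_subset[OF U(1)] by simp
  then have card: "card U \<ge> 1" using U(2) by (simp add: Suc_le_eq card_gt_0_iff)
  note eqs = sqfree_Un_multiples[OF F G U(1)] sqfree_Int_multiples[OF F G U(1) FG]
  have up: "upclosed n (sqfree n F)" "upclosed n ((+) (var_prod U) ` sqfree n G)"
    using F G U by (auto intro!: upclosed_shift upclosed_sqfree var_prod_mons)
  have r1: "reg_le (sqfree n F) r" using rF card by (rule_tac reg_le_mono) auto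
  have r2: "reg_le ((+) (var_prod U) ` sqfree n G) r"
    using reg_le_shift[OF upclosed_sqfree[OF G(1)] var_prod_mons[OF U(1)] rG] fin by simp
  have r3: "reg_le (sqfree n F \<inter> (+) (var_prod U) ` sqfree n G) (r + 1)" unfolding eqs
    using reg_le_shift[OF upclosed_sqfree[OF F(1)] var_prod_mons[OF U(1)] rF] fin by simp
  show "reg_le (sqfree n (F \<union> {X. U \<subseteq> X \<and> X \<in> G})) r"
    unfolding eqs by (rule reg_le_Un[OF up r1 r2 r3])
  assume a: "attains (sqfree n F) (r + 1 - int (card U))"
  have a3: "attains (sqfree n F \<inter> (+) (var_prod U) ` sqfree n G) (r + 1)" unfolding eqs
    using attains_shift[OF upclosed_sqfree[OF F(1)] var_prod_mons[OF U(1)] a] fin by simp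
  show "attains (sqfree n (F \<union> {X. U \<subseteq> X \<and> X \<in> G})) r"
    unfolding eqs by (rule attains_Un[OF up r1 r2 a3])
qed

end

section \<open>Regularity of the families of monomials\<close>

text \<open>
  With the variables \<open>a\<^sub>k, b\<^sub>k, z\<^sub>k\<close> indexed by \<open>2k\<close>, \<open>2k + 1\<close> and \<open>2s + k\<close>: \<open>touching Y\<close> is the ideal generated
  by the variables in \<open>Y\<close>; \<open>containing Y\<close> is the principal ideal of their product; \<open>pairs k\<close> is the complete
  intersection \<open>(a\<^sub>0 b\<^sub>0, \<dots>, a\<^bsub>k-1\<^esub> b\<^bsub>k-1\<^esub>)\<close>. For \<open>p = 2s\<close>, the ideal \<open>staircase p k F\<close> adds to \<open>F\<close> the products
  of each of \<open>z\<^sub>0, \<dots>, z\<^bsub>k-1\<^esub>\<close> with all variables of smaller index. Finally \<open>cubics s k\<close> is generated by those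
  \<open>a\<^sub>i b\<^sub>i z\<^sub>i\<close> and those squarefree cubics with at least two \<open>z\<close>'s which involve only \<open>z\<^sub>0, \<dots>, z\<^bsub>k-1\<^esub>\<close>
  among the \<open>z\<close>'s. Its generators are sorted by the largest \<open>z\<^sub>i\<close> that occurs in them, the order in
  which the step lemma adjoins them.
\<close>

definition touching :: "nat set \<Rightarrow> nat set set" where
  "touching Y = {X. X \<inter> Y \<noteq> {}}"

definition containing :: "nat set \<Rightarrow> nat set set" where
  "containing Y = {X. Y \<subseteq> X}"

definition pairs :: "nat \<Rightarrow> nat set set" where
  "pairs k = (\<Union>i<k. containing {2 * i, 2 * i + 1})"

definition staircase :: "nat \<Rightarrow> nat \<Rightarrow> nat set set \<Rightarrow> nat set set" where
  "staircase p k F = F \<union> {X. \<exists>z\<in>X. p \<le> z \<and> z < p + k \<and> X \<in> touching {..<z}}"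

definition cubics :: "nat \<Rightarrow> nat \<Rightarrow> nat set set" where
  "cubics s k = {X. \<exists>i<k. 2 * s + i \<in> X \<and> X \<in> staircase (2 * s) i (containing {2 * i, 2 * i + 1})}"

lemma upward_containing: "upward (containing Y)"
  by (auto simp: upward_def containing_def)

lemma upward_touching: "upward (touching Y)"
  by (auto simp: upward_def touching_def)

lemma upward_pairs: "upward (pairs k)"
  unfolding pairs_def containing_def upward_def by blast

lemma upward_staircase: "upward F \<Longrightarrow> upward (staircase p k F)"
  unfolding upward_def staircase_def touching_def by blast

lemma upward_cubics: "upward (cubics s k)"
  using upward_staircase[OF upward_containing] unfolding cubics_def upward_def by blast

text \<open>
  The recursions that present each family as the result of a step of the form \<open>J + u J'\<close>.
\<close>

lemma touching_insert: "touching (insert y Y) = touching Y \<union> {X. {y} \<subseteq> X \<and> X \<in> UNIV}"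
  by (auto simp: touching_def)

lemma pairs_Suc: "pairs (Suc k) = pairs k \<union> {X. {2 * k, 2 * k + 1} \<subseteq> X \<and> X \<in> UNIV}"
  by (auto simp: pairs_def containing_def lessThan_Suc)

lemma staircase_Suc: "staircase p (Suc k) F = staircase p k F \<union> {X. {p + k} \<subseteq> X \<and> X \<in> touching {..<p + k}}"
proof -
  have "(\<exists>z\<in>X. p \<le> z \<and> z < p + Suc k \<and> X \<in> touching {..<z}) \<longleftrightarrow>
      (\<exists>z\<in>X. p \<le> z \<and> z < p + k \<and> X \<in> touching {..<z}) \<or> p + k \<in> X \<and> X \<in> touching {..<p + k}" for X
    by (metis add_Suc_right le_add1 less_Suc_eq)
  then show ?thesis unfolding staircase_def by auto
qed

lemma cubics_Suc: "cubics s (Suc k) = cubics s k \<union>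
   {X. {2 * s + k} \<subseteq> X \<and> X \<in> staircase (2 * s) k (containing {2 * k, 2 * k + 1})}"
  by (auto simp: cubics_def less_Suc_eq)

context residue_field_resolution
begin

lemma attains_mons: "attains (mons n) 0"
  using attains_initial_degree[of "mons n" 0] by simp

lemma reg_le_containing: "U \<subseteq> {..<n} \<Longrightarrow> U \<noteq> {} \<Longrightarrow> reg_le (sqfree n (containing U)) (int (card U))"
  using reg_le_Un_multiples(1)[of "{}" U UNIV "int (card U)"]
  by (simp add: containing_def upward_def ignores_def reg_le_empty reg_le_mons)

lemma attains_containing: "U \<subseteq> {..<n} \<Longrightarrow> attains (sqfree n (containing U)) (int (card U))"
  using sqfree_Un_multiples[of "{}" U UNIV n] attains_shift[OF upclosed_mons var_prod_mons attains_mons, of U]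
   finite_subset[of U "{..<n}"]
  by (simp add: containing_def upward_def ignores_def)

lemma reg_le_touching:
  assumes "Y \<subseteq> {..<n}"
  shows "reg_le (sqfree n (touching Y)) 1"
proof -
  have "finite Y" using assms finite_subset by blast
  then show ?thesis using assms
  proof (induction Y)
    case empty
    then show ?case by (simp add: touching_def reg_le_empty)
  next
    case (insert y Y)
    then show ?case unfolding touching_insert
      by (intro reg_le_Un_multiples(1) upward_touching) (auto simp: touching_def upward_def ignores_def reg_le_mons)
  qed
qed

text \<open>
  Each new quadric involves new variables only; it raises the regularity by its degree minus one.
\<close>

lemma pairs_regularity:
  assumes "2 * k \<le> n" "0 < k"
  shows "reg_le (sqfree n (pairs k)) (int k + 1) \<and> attains (sqfree n (pairs k)) (int k + 1)"
  using assms
proof (induction k)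
  case (Suc k)
  show ?case
  proof (cases "k = 0")
    case True
    then show ?thesis using reg_le_containing[of "{0,1}"] attains_containing[of "{0,1}"] Suc.prems
      by (simp add: pairs_def lessThan_Suc)
  next
    case False
    let ?U = "{2 * k, 2 * k + 1}"
    have "X - ?U \<in> pairs k" if X: "X \<in> pairs k" for X
    proof -
      obtain i where i: "i < k" "{2 * i, 2 * i + 1} \<subseteq> X" using X by (auto simp: pairs_def containing_def)
      then have "2 * i \<noteq> 2 * k + 1" "2 * i + 1 \<noteq> 2 * k" by presburger+
      with i show ?thesis by (auto simp: pairs_def containing_def)
    qed
    then have "ignores (pairs k) ?U" by (simp add: ignores_def)
    note * = reg_le_Un_multiples[where U = ?U and F = "pairs k" and G = UNIV and r = "int (Suc k) + 1",
       OF upward_pairs this, folded pairs_Suc]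
    show ?thesis using Suc False by (intro conjI *) (auto simp: upward_def ignores_def add.commute intro: reg_le_mono reg_le_mons)
  qed
qed simp

text \<open>
  Adjoining \<open>z\<^sub>k\<close> times all smaller variables is a step where \<open>J'\<close> is generated by these variables and has
  regularity one. It does not change the regularity of \<open>J\<close>, if this is at least two.
\<close>

lemma staircase_regularity:
  assumes F: "upward F" "\<And>X. X \<in> F \<Longrightarrow> X \<inter> {..<p} \<in> F" "{} \<notin> F" and "p + k \<le> n" "2 \<le> r"
    and r: "reg_le (sqfree n F) r"
  shows "reg_le (sqfree n (staircase p k F)) r"
    and "attains (sqfree n F) r \<Longrightarrow> attains (sqfree n (staircase p k F)) r"
proof -
  have "reg_le (sqfree n (staircase p k F)) r \<and>
     (attains (sqfree n F) r \<longrightarrow> attains (sqfree n (staircase p k F)) r)"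
    using \<open>p + k \<le> n\<close>
  proof (induction k)
    case 0
    have "staircase p 0 F = F" by (auto simp: staircase_def)
    then show ?case using r by simp
  next
    case (Suc k)
    have "X - {p + k} \<in> staircase p k F" if X: "X \<in> staircase p k F" for X
    proof (cases "X \<in> F")
      case True
      then show ?thesis using upwardD[OF F(1) F(2)[OF True], of "X - {p + k}"] by (auto simp: staircase_def)
    next
      case False
      then show ?thesis using X by (fastforce simp: staircase_def touching_def)
    qed
    then have "ignores (staircase p k F) {p + k}" by (simp add: ignores_def)
    note * = reg_le_Un_multiples[where U = "{p + k}" and F = "staircase p k F" and G = "touching {..<p + k}" and r = r,
       OF upward_staircase[OF F(1)] this upward_touching, folded staircase_Suc]
    have sub: "staircase p k F \<subseteq> touching {..<p + k}"
    proof
      fix X assume X: "X \<in> staircase p k F"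
      show "X \<in> touching {..<p + k}"
      proof (cases "X \<in> F")
        case True
        then have "X \<inter> {..<p} \<noteq> {}" using F by metis
        then show ?thesis by (auto simp: touching_def)
      next
        case False
        then show ?thesis using X by (fastforce simp: staircase_def touching_def)
      qed
    qed
    have "reg_le (sqfree n (touching {..<p + k})) (r - 1)"
      using reg_le_mono[OF reg_le_touching[of "{..<p + k}"]] Suc.prems \<open>2 \<le> r\<close> by simp
    then show ?case using Suc sub by (intro conjI impI *) (auto simp: touching_def ignores_def)
  qed
  then show "reg_le (sqfree n (staircase p k F)) r"
    "attains (sqfree n F) r \<Longrightarrow> attains (sqfree n (staircase p k F)) r" by auto
qed

text \<open>
  The generators of \<open>cubics s (Suc k)\<close> divisible by \<open>z\<^sub>k\<close> are \<open>z\<^sub>k\<close> times the generators of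
  \<open>J' = (a\<^sub>k b\<^sub>k) + \<Sum>\<^bsub>i<k\<^esub> z\<^sub>i (x\<^sub>v : v < 2s + i)\<close>, a staircase over the single quadric \<open>a\<^sub>k b\<^sub>k\<close>, which has
  regularity two.
\<close>

lemma reg_le_cubics:
  assumes "k \<le> s" "3 * s \<le> n"
  shows "reg_le (sqfree n (cubics s k)) 3"
  using assms(1)
proof (induction k)
  case 0
  then show ?case by (simp add: cubics_def reg_le_empty)
next
  case (Suc k)
  let ?P = "containing {2 * k, 2 * k + 1}"
  let ?G = "staircase (2 * s) k ?P"
  have G: "X - {2 * s + k} \<in> ?G" if "X \<in> ?G" for X
    using that Suc.prems by (fastforce simp: staircase_def containing_def touching_def)
  have F: "X - {2 * s + k} \<in> cubics s k" if "X \<in> cubics s k" for X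
    using that Suc.prems by (fastforce simp: cubics_def staircase_def containing_def touching_def)
  have sub: "cubics s k \<subseteq> ?G"
  proof
    fix X assume "X \<in> cubics s k"
    then obtain i where i: "i < k" "2 * s + i \<in> X" "X \<in> staircase (2 * s) i (containing {2 * i, 2 * i + 1})"
      by (auto simp: cubics_def)
    then have "X \<in> touching {..<2 * s + i}"
      using Suc.prems by (fastforce simp: staircase_def touching_def containing_def)
    then show "X \<in> ?G" using i by (auto simp: staircase_def)
  qed
  have "reg_le (sqfree n ?P) 2"
    using reg_le_containing[of "{2 * k, 2 * k + 1}"] Suc.prems assms(2) by simp
  then have rG: "reg_le (sqfree n ?G) 2"
    using Suc.prems assms(2)
    by (intro staircase_regularity(1) upward_containing) (auto simp: containing_def)
  show ?case unfolding cubics_Suc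
    using Suc assms(2) sub F G rG
    by (intro reg_le_Un_multiples(1) upward_cubics upward_staircase upward_containing)
       (auto simp: ignores_def)
qed

end

section \<open>The Koszul complex\<close>

lemma sum_lessThan_add: "(\<Sum>c<a + (b::nat). f c) = (\<Sum>c<a. f c) + (\<Sum>c<b. f (a + c) :: 'a::comm_monoid_add)"
  by (induction b) (simp_all add: add.assoc)

definition join :: "nat \<Rightarrow> (nat \<Rightarrow> 'a) \<Rightarrow> (nat \<Rightarrow> 'a) \<Rightarrow> nat \<Rightarrow> 'a" where
  "join a p q = (\<lambda>b. if b < a then p b else q (b - a))"

text \<open>
  The mapping cone of multiplication by a linear form \<open>x\<close> on \<open>C\<close>. In homological degree \<open>i\<close> the basis elements
  of \<open>C\<^sub>i\<close> come first and are followed by those of \<open>C\<^bsub>i-1\<^esub>\<close>, shifted in degree by one. A chain is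
  accordingly of the form \<open>join a p q\<close> where \<open>a\<close> is the rank of \<open>C\<^sub>i\<close>, and the boundary maps \<open>(p, q)\<close> to
  \<open>(\<partial>p + x q, -\<partial>q)\<close>.
\<close>

definition cone :: "('k::field) mpoly \<Rightarrow> 'k free_complex \<Rightarrow> 'k free_complex" where
  "cone x C = \<lparr>rk = (\<lambda>i. rk C i + (case i of 0 \<Rightarrow> 0 | Suc k \<Rightarrow> rk C k)),
     gen_deg = (\<lambda>i b. if b < rk C i then gen_deg C i b else gen_deg C (i - 1) (b - rk C i) + 1),
     dmat = (\<lambda>i b c.
       if c < rk C (Suc i) then if b < rk C i then dmat C i b c else 0
       else if b < rk C i then if b = c - rk C (Suc i) then x else 0
       else - dmat C (i - 1) (b - rk C i) (c - rk C (Suc i)))\<rparr>"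

lemma rk_cone: "rk (cone x C) i = rk C i + (case i of 0 \<Rightarrow> 0 | Suc k \<Rightarrow> rk C k)"
  by (simp add: cone_def)

lemma rk_cone_0 [simp]: "rk (cone x C) 0 = rk C 0"
  and rk_cone_Suc [simp]: "rk (cone x C) (Suc k) = rk C (Suc k) + rk C k"
  by (simp_all add: cone_def)

lemma join_chains:
  "p \<in> chains C M (Suc k) \<Longrightarrow> q \<in> chains C M k \<Longrightarrow> join (rk C (Suc k)) p q \<in> chains (cone x C) M (Suc k)"
  by (auto simp: chains_def join_def)

lemma chains_coneE:
  assumes "v \<in> chains (cone x C) M (Suc k)"
  obtains p q where "p \<in> chains C M (Suc k)" "q \<in> chains C M k" "v = join (rk C (Suc k)) p q"
proof
  let ?a = "rk C (Suc k)"
  show "(\<lambda>b. if b < ?a then v b else 0) \<in> chains C M (Suc k)"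
    using assms by (auto simp: chains_def)
  show "(\<lambda>b. v (?a + b)) \<in> chains C M k"
    using assms by (auto simp: chains_def)
  show "v = join ?a (\<lambda>b. if b < ?a then v b else 0) (\<lambda>b. v (?a + b))"
    by (auto simp: join_def)
qed

lemma boundary_cone:
  "boundary (cone x C) i (join (rk C (Suc i)) p q) b =
     (if b < rk C i then boundary C i p b + x * q b
      else case i of 0 \<Rightarrow> 0 | Suc k \<Rightarrow> - boundary C k q (b - rk C i))"
proof (cases "b < rk C i")
  case True
  have "(\<Sum>c<rk C i. (if b = c then x else 0) * q c) = (\<Sum>c<rk C i. if c = b then x * q c else 0)"
    by (intro sum.cong) auto
  also have "\<dots> = x * q b" using True by simp
  finally have "(\<Sum>c<rk C i. (if b = c then x else 0) * q c) = x * q b" .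
  then show ?thesis using True
    by (simp add: boundary_def sum_lessThan_add rk_cone cone_def join_def)
next
  case False
  then show ?thesis
  proof (cases i)
    case (Suc k)
    show ?thesis
    proof (cases "b - rk C i < rk C k")
      case True
      then have "b < rk (cone x C) i" using Suc False by simp
      then show ?thesis using False True unfolding Suc
        by (simp add: boundary_def sum_lessThan_add) (simp add: cone_def join_def sum_negf)
    next
      case False2: False
      then show ?thesis using False Suc by (simp add: boundary_def)
    qed
  qed (simp add: boundary_def)
qed

lemma boundary_cone_Suc:
  "boundary (cone x C) (Suc k) (join (rk C (Suc (Suc k))) p q) =
    join (rk C (Suc k)) (\<lambda>b. boundary C (Suc k) p b + x * q b) (\<lambda>b. - boundary C k q b)"
  by (rule ext) (simp add: boundary_cone, simp add: join_def)

lemma boundary_uminus: "boundary C i (\<lambda>b. - v b) = (\<lambda>b. - boundary C i v b)"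
  by (auto simp: boundary_def fun_eq_iff sum_negf)

lemma boundary_zero: "boundary C i (\<lambda>b. 0) = (\<lambda>b. 0)"
  by (auto simp: boundary_def fun_eq_iff)

lemma boundary_chains:
  assumes "\<forall>b<rk C i. \<forall>c<rk C (Suc i). dmat C i b c \<in> supported (mons n)"
    "v \<in> chains C (supported (mons n)) (Suc i)"
  shows "boundary C i v \<in> chains C (supported (mons n)) i"
  using assms unfolding chains_def boundary_def
  by (auto intro!: supported_sum supported_mult_upclosed[of n])

text \<open>
  The complex \<open>C\<close> is a graded free resolution of the quotient by the first \<open>m\<close> variables, the generator of
  the free module of rank one in homological degree zero having degree zero.
\<close>

definition resolves_first_variables :: "nat \<Rightarrow> nat \<Rightarrow> ('k::field) free_complex \<Rightarrow> bool" where
  "resolves_first_variables n m C \<longleftrightarrow>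
     (\<forall>i. \<forall>b<rk C i. \<forall>c<rk C (Suc i). dmat C i b c \<in> supported (mons n) \<and>
        dmat C i b c \<in> supported (of_degree (gen_deg C (Suc i) c - gen_deg C i b))) \<and>
     rk C 0 = 1 \<and> gen_deg C 0 0 = 0 \<and>
     boundary C 0 ` chains C (supported (mons n)) (Suc 0) =
       {v \<in> chains C (supported (mons n)) 0. v 0 \<in> supported (sqfree n (touching {..<m}))} \<and>
     (\<forall>i. {v \<in> chains C (supported (mons n)) (Suc i). boundary C i v = (\<lambda>_. 0)} =
       boundary C (Suc i) ` chains C (supported (mons n)) (Suc (Suc i)))"

lemma resolves_no_variables:
  "resolves_first_variables n 0 \<lparr>rk = (\<lambda>i. if i = 0 then 1 else 0), gen_deg = (\<lambda>_ _. 0), dmat = (\<lambda>_ _ _. 0)\<rparr>"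
  (is "resolves_first_variables n 0 ?C")
proof -
  have pos: "chains ?C (supported (mons n)) (Suc i) = {\<lambda>_. 0}" for i
    by (auto simp: chains_def)
  have im0: "{v \<in> chains ?C (supported (mons n)) 0. v 0 \<in> supported (sqfree n (touching {..<0}))} = {\<lambda>_. 0}"
    (is "?L = _")
  proof -
    have "v b = 0" if "v \<in> ?L" for v b
      using that by (cases b) (auto simp: chains_def touching_def supported_def)
    then have "?L \<subseteq> {\<lambda>_. 0}" by blast
    moreover have "(\<lambda>_. 0) \<in> ?L" by (simp add: chains_def)
    ultimately show ?thesis by blast
  qed
  have ex: "{v \<in> {\<lambda>_. 0}. boundary ?C i v = (\<lambda>_. 0)} = {\<lambda>_. 0}" for i
    using boundary_zero[of ?C i] by blast
  show ?thesis
    unfolding resolves_first_variables_def pos im0 image_insert image_empty boundary_zero ex by simp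
qed

text \<open>
  The variable \<open>x\<close> of index \<open>m\<close> is a nonzerodivisor modulo the smaller variables. This is what exactness in
  homological degree one needs: if \<open>\<partial>p + x q = 0\<close> then \<open>x q\<close>, and therefore \<open>q\<close>, is in the ideal of the
  smaller variables, which is the image of \<open>\<partial>\<close>. In higher degrees \<open>q\<close> is a cycle of \<open>C\<close>. In both cases
  \<open>q = \<partial>q'\<close>, the chain \<open>p + x q'\<close> is a cycle and equal to some \<open>\<partial>p'\<close>, and \<open>(p, q)\<close> is the boundary of
  \<open>(p', -q')\<close>.
\<close>

lemma resolves_cone:
  assumes C: "resolves_first_variables n m C" and m: "m < n"
  shows "resolves_first_variables n (Suc m) (cone (monomial (Poly_Mapping.single m 1)) C)"
proof -
  define x :: "'a mpoly" where "x = monomial (Poly_Mapping.single m 1)"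
  let ?S = "supported (mons n) :: 'a mpoly set"
  let ?V = "\<lambda>m. sqfree n (touching {..<m})"
  have x: "x \<in> ?S" "x \<in> supported (of_degree 1)"
    using m by (auto simp: x_def of_degree_def)
  have vp: "var_prod {m} = Poly_Mapping.single m 1" by (simp add: var_prod_def)
  have V: "?V (Suc m) = ?V m \<union> (+) (Poly_Mapping.single m 1) ` mons n"
    "?V m \<inter> (+) (Poly_Mapping.single m 1) ` mons n = (+) (Poly_Mapping.single m 1) ` ?V m"
  proof -
    have *: "upward (touching {..<m})" "ignores (touching {..<m}) {m}" "upward UNIV" "ignores UNIV {m}"
      "{m} \<subseteq> {..<n}"
      using m by (auto simp: upward_touching) (auto simp: upward_def ignores_def touching_def)
    show "?V (Suc m) = ?V m \<union> (+) (Poly_Mapping.single m 1) ` mons n"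
      using sqfree_Un_multiples[OF *] by (simp only: touching_insert[symmetric] lessThan_Suc vp sqfree_UNIV)
    show "?V m \<inter> (+) (Poly_Mapping.single m 1) ` mons n = (+) (Poly_Mapping.single m 1) ` ?V m"
      using sqfree_Int_multiples[OF *] by (simp add: vp)
  qed
  have mat: "dmat C i b c \<in> ?S" "dmat C i b c \<in> supported (of_degree (gen_deg C (Suc i) c - gen_deg C i b))"
    if "b < rk C i" "c < rk C (Suc i)" for i b c
    using C that by (auto simp: resolves_first_variables_def)
  have rk0: "rk C 0 = 1" "gen_deg C 0 0 = 0" using C by (auto simp: resolves_first_variables_def)
  have im0: "boundary C 0 ` chains C ?S (Suc 0) = {v \<in> chains C ?S 0. v 0 \<in> supported (?V m)}"
    using C by (auto simp: resolves_first_variables_def)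
  have ex: "{v \<in> chains C ?S (Suc i). boundary C i v = (\<lambda>_. 0)} = boundary C (Suc i) ` chains C ?S (Suc (Suc i))" for i
    using C by (auto simp: resolves_first_variables_def)
  have bch: "boundary C i v \<in> chains C ?S i" if "v \<in> chains C ?S (Suc i)" for v i
    using that mat by (intro boundary_chains) auto
  have xch: "(\<lambda>b. x * v b) \<in> chains C ?S i" if "v \<in> chains C ?S i" for v i
    using that x by (auto simp: chains_def intro: supported_mult_upclosed[OF upclosed_mons])
  have nch: "(\<lambda>b. - v b) \<in> chains C ?S i" if "v \<in> chains C ?S i" for v i
    using that by (auto simp: chains_def supported_uminus)
  have ddz: "boundary C i (boundary C (Suc i) v) = (\<lambda>_. 0)" if "v \<in> chains C ?S (Suc (Suc i))" for v i
    using ex[of i] that by blast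

  have mat': "dmat (cone x C) i b c \<in> ?S \<and> dmat (cone x C) i b c \<in>
      supported (of_degree (gen_deg (cone x C) (Suc i) c - gen_deg (cone x C) i b))"
    if bc: "b < rk (cone x C) i" "c < rk (cone x C) (Suc i)" for i b c
  proof (cases "b < rk C i \<or> c < rk C (Suc i)")
    case True
    then show ?thesis using bc mat x by (auto simp: cone_def)
  next
    case False
    then obtain k where k: "i = Suc k" using bc by (cases i) auto
    then have "b - rk C i < rk C k" "c - rk C (Suc i) < rk C (Suc k)" using bc False by auto
    from mat[OF this] show ?thesis using False k by (simp add: cone_def supported_uminus)
  qed

  have im0': "boundary (cone x C) 0 ` chains (cone x C) ?S (Suc 0) =
       {v \<in> chains (cone x C) ?S 0. v 0 \<in> supported (?V (Suc m))}" (is "?L = ?R")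
  proof (intro equalityI subsetI)
    fix v assume "v \<in> ?L"
    then obtain z where z: "z \<in> chains (cone x C) ?S (Suc 0)" "v = boundary (cone x C) 0 z" by auto
    from chains_coneE[OF z(1)] obtain p q where pq: "p \<in> chains C ?S (Suc 0)" "q \<in> chains C ?S 0"
      "z = join (rk C (Suc 0)) p q" .
    have v0: "v b = (if b < rk C 0 then boundary C 0 p b + x * q b else 0)" for b
      by (simp add: z pq boundary_cone)
    have "boundary C 0 p \<in> {v \<in> chains C ?S 0. v 0 \<in> supported (?V m)}" using im0 pq(1) by blast
    then have 1: "boundary C 0 p 0 \<in> supported (?V (Suc m))"
      using supported_mono[of "?V m" "?V (Suc m)"] V(1) by auto
    have "q 0 \<in> ?S" using pq(2) rk0 by (auto simp: chains_def)
    then have "x * q 0 \<in> supported ((+) (Poly_Mapping.single m 1) ` mons n)"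
      unfolding x_def supported_shift_iff .
    then have "x * q 0 \<in> supported (?V (Suc m))"
      using supported_mono[of "(+) (Poly_Mapping.single m 1) ` mons n" "?V (Suc m)"] V(1) by auto
    with 1 have "v 0 \<in> supported (?V (Suc m))" using v0 rk0 by (simp add: supported_add)
    moreover have "v \<in> chains (cone x C) ?S 0"
      unfolding z(2) using z(1) mat' by (intro boundary_chains) auto
    ultimately show "v \<in> ?R" by simp
  next
    fix v assume v: "v \<in> ?R"
    let ?r = "restr (?V m) (v 0)"
    have v0: "v 0 \<in> supported (?V m \<union> (+) (Poly_Mapping.single m 1) ` mons n)"
      using v unfolding V(1) by simp
    from diff_restr_supported[OF this]
    obtain r where r: "v 0 - ?r = x * r" "r \<in> ?S" unfolding x_def by (rule supported_shiftE)
    from r(1) have v0r: "?r + x * r = v 0" by (metis diff_add_cancel add.commute)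
    have "?r \<in> supported (?V m)" by (rule restr_supported)
    moreover have "?V m \<subseteq> mons n" by (auto simp: sqfree_def)
    ultimately have "(\<lambda>b. if b = 0 then ?r else 0) \<in> {v \<in> chains C ?S 0. v 0 \<in> supported (?V m)}"
      using supported_mono[of "?V m" "mons n"] rk0 by (auto simp: chains_def)
    then obtain p where p: "p \<in> chains C ?S (Suc 0)" "(\<lambda>b. if b = 0 then ?r else 0) = boundary C 0 p"
      unfolding im0[symmetric] by blast
    define q where "q b = (if b = 0 then r else 0)" for b :: nat
    have q: "q \<in> chains C ?S 0" using r rk0 by (auto simp: chains_def q_def)
    have "v b = boundary (cone x C) 0 (join (rk C (Suc 0)) p q) b" for b
    proof (cases "b = 0")
      case True
      then show ?thesis using rk0 by (simp add: boundary_cone p(2)[symmetric] q_def v0r)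
    next
      case False
      then show ?thesis using rk0 v by (simp add: boundary_cone chains_def)
    qed
    then show "v \<in> ?L" using join_chains[OF p(1) q] by blast
  qed

  have ex': "{v \<in> chains (cone x C) ?S (Suc i). boundary (cone x C) i v = (\<lambda>_. 0)} =
      boundary (cone x C) (Suc i) ` chains (cone x C) ?S (Suc (Suc i))" (is "?L = ?R") for i
  proof (intro equalityI subsetI)
    fix v assume "v \<in> ?R"
    then obtain z where z: "z \<in> chains (cone x C) ?S (Suc (Suc i))" "v = boundary (cone x C) (Suc i) z" by auto
    from chains_coneE[OF z(1)] obtain p q where pq: "p \<in> chains C ?S (Suc (Suc i))" "q \<in> chains C ?S (Suc i)"
      "z = join (rk C (Suc (Suc i))) p q" .
    have "boundary (cone x C) i v b = 0" for b
      unfolding z(2) pq(3) boundary_cone_Suc boundary_cone boundary_add boundary_mult boundary_uminus ddz[OF pq(1)]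
      using ddz pq(2) by (auto split: nat.split)
    moreover have "v \<in> chains (cone x C) ?S (Suc i)"
      unfolding z(2) using z(1) mat' by (intro boundary_chains) auto
    ultimately show "v \<in> ?L" by auto
  next
    fix v assume v: "v \<in> ?L"
    then have "v \<in> chains (cone x C) ?S (Suc i)" by simp
    from chains_coneE[OF this] obtain p q where pq: "p \<in> chains C ?S (Suc i)" "q \<in> chains C ?S i"
      "v = join (rk C (Suc i)) p q" .
    have dv: "boundary (cone x C) i (join (rk C (Suc i)) p q) b = 0" for b
      using v pq(3) by simp
    have dp: "boundary C i p b + x * q b = 0" for b
    proof (cases "b < rk C i")
      case True
      then show ?thesis using dv[of b] by (simp add: boundary_cone)
    next
      case False
      then show ?thesis using pq(2) by (simp add: boundary_def chains_def)
    qed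
    have "\<exists>q'\<in>chains C ?S (Suc i). q = boundary C i q'"
    proof (cases i)
      case 0
      have "boundary C 0 p \<in> {v \<in> chains C ?S 0. v 0 \<in> supported (?V m)}" using im0 pq(1) 0 by blast
      then have "- boundary C 0 p 0 \<in> supported (?V m)" by (simp add: supported_uminus)
      moreover have "x * q 0 = - boundary C 0 p 0"
        using dp[of 0] 0 by (simp add: eq_neg_iff_add_eq_0 add.commute)
      ultimately have "x * q 0 \<in> supported (?V m)" by simp
      moreover have "q 0 \<in> ?S" using pq(2) rk0 0 by (auto simp: chains_def)
      then have "x * q 0 \<in> supported ((+) (Poly_Mapping.single m 1) ` mons n)"
        unfolding x_def supported_shift_iff .
      ultimately have "x * q 0 \<in> supported ((+) (Poly_Mapping.single m 1) ` ?V m)"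
        unfolding V(2)[symmetric] supported_Int by blast
      then have "q 0 \<in> supported (?V m)" unfolding x_def supported_shift_iff .
      then have "q \<in> boundary C 0 ` chains C ?S (Suc 0)" unfolding im0 using pq(2) 0 by simp
      then show ?thesis using 0 by auto
    next
      case (Suc k)
      have "boundary C k q b = 0" for b
        using dv[of "rk C i + b"] by (simp add: boundary_cone Suc)
      then have "q \<in> {v \<in> chains C ?S (Suc k). boundary C k v = (\<lambda>_. 0)}" using pq(2) Suc by auto
      then show ?thesis unfolding ex Suc by auto
    qed
    then obtain q' where q': "q' \<in> chains C ?S (Suc i)" "q = boundary C i q'" by blast
    have "(\<lambda>b. p b + x * q' b) \<in> {v \<in> chains C ?S (Suc i). boundary C i v = (\<lambda>_. 0)}"
      using dp chains_add[OF pq(1) xch[OF q'(1)]] by (simp add: boundary_add boundary_mult q'(2)[symmetric])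
    then obtain p' where p': "p' \<in> chains C ?S (Suc (Suc i))" "(\<lambda>b. p b + x * q' b) = boundary C (Suc i) p'"
      unfolding ex by blast
    have "boundary (cone x C) (Suc i) (join (rk C (Suc (Suc i))) p' (\<lambda>b. - q' b)) = v"
      unfolding boundary_cone_Suc pq(3) boundary_uminus p'(2)[symmetric] q'(2)[symmetric] by simp
    then show "v \<in> ?R" using join_chains[OF p'(1) nch[OF q'(1)]] by blast
  qed

  show ?thesis
    unfolding resolves_first_variables_def x_def[symmetric]
    using mat' rk0 im0' ex' by (simp add: cone_def[of x C])
qed

lemma resolution_of_residue_field_exists:
  "\<exists>(C :: ('k::field) free_complex) \<epsilon>. graded_free_resolution_of_residue_field n C \<epsilon>"
proof -
  have "\<exists>C :: 'k free_complex. resolves_first_variables n m C" if "m \<le> n" for m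
    using that
  proof (induction m)
    case 0
    then show ?case using resolves_no_variables by blast
  next
    case (Suc m)
    then show ?case using resolves_cone by (metis Suc_leD Suc_le_lessD)
  qed
  then obtain C :: "'k free_complex" where C: "resolves_first_variables n n C" by blast
  have "v 0 \<in> supported (sqfree n (touching {..<n})) \<longleftrightarrow> augmentation C (\<lambda>_. 1) v = 0"
    if "v \<in> chains C (supported (mons n)) 0" for v
  proof -
    have rk0: "rk C 0 = 1" using C by (simp add: resolves_first_variables_def)
    then have "v 0 \<in> supported (mons n)" using that by (auto simp: chains_def)
    moreover have "sqfree n (touching {..<n}) = mons n - {0}"
      by (auto simp: sqfree_def touching_def mons_def) (metis Int_absorb2 keys_eq_empty)
    ultimately have "v 0 \<in> supported (sqfree n (touching {..<n})) \<longleftrightarrow> 0 \<notin> Poly_Mapping.keys (v 0)"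
      by (auto simp: supported_def)
    then show ?thesis using rk0 by (simp add: augmentation_def in_keys_iff)
  qed
  then have "graded_free_resolution_of_residue_field n C (\<lambda>_. 1)"
    using C unfolding graded_free_resolution_of_residue_field_def resolves_first_variables_def
      carrier_polyring homogeneous_iff by auto
  then show ?thesis by blast
qed

section \<open>Generators and gradient ideals of equigenerated monomial ideals\<close>

lemma polyring_ops [simp]:
  "x \<otimes>\<^bsub>polyring n\<^esub> y = x * y" "x \<oplus>\<^bsub>polyring n\<^esub> y = x + y"
  "\<zero>\<^bsub>polyring n\<^esub> = 0" "\<one>\<^bsub>polyring n\<^esub> = 1"
  by (simp_all add: polyring_def)

lemma abelian_group_polyring: "abelian_group (polyring n)"
proof (rule abelian_groupI)
  fix p :: "'a mpoly" assume p: "p \<in> carrier (polyring n)"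
  then have "- p \<in> carrier (polyring n)" by (simp add: carrier_polyring supported_uminus)
  moreover have "- p \<oplus>\<^bsub>polyring n\<^esub> p = \<zero>\<^bsub>polyring n\<^esub>" by simp
  ultimately show "\<exists>q\<in>carrier (polyring n). q \<oplus>\<^bsub>polyring n\<^esub> p = \<zero>\<^bsub>polyring n\<^esub>" by blast
qed (simp_all add: carrier_polyring supported_add add_ac)

lemma ring_polyring: "ring (polyring n :: ('k::field) mpoly ring)"
proof (rule ring.intro[OF abelian_group_polyring])
  show "monoid (polyring n :: 'k mpoly ring)"
  proof (rule monoidI)
    show "\<one>\<^bsub>polyring n\<^esub> \<in> carrier (polyring n :: 'k mpoly ring)"
      by (simp add: carrier_polyring supported_def)
    fix p q :: "'k mpoly" assume "p \<in> carrier (polyring n)" "q \<in> carrier (polyring n)"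
    then show "p \<otimes>\<^bsub>polyring n\<^esub> q \<in> carrier (polyring n)"
      unfolding carrier_polyring polyring_ops by (rule supported_mult) simp
  qed (simp_all add: mult_ac)
  show "ring_axioms (polyring n :: 'k mpoly ring)" by unfold_locales (simp_all add: algebra_simps)
qed

lemma ideal_polyringI:
  fixes I :: "('k::field) mpoly set"
  assumes "I \<subseteq> carrier (polyring n)" "0 \<in> I" "\<And>p q. p \<in> I \<Longrightarrow> q \<in> I \<Longrightarrow> p + q \<in> I"
    "\<And>p q. p \<in> carrier (polyring n) \<Longrightarrow> q \<in> I \<Longrightarrow> p * q \<in> I"
  shows "ideal I (polyring n)"
proof (rule idealI[OF ring_polyring])
  interpret R: ring "polyring n :: 'k mpoly ring" by (rule ring_polyring)
  show "subgroup I (add_monoid (polyring n :: 'k mpoly ring))"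
  proof (rule R.add.subgroupI)
    fix p assume p: "p \<in> I"
    have m: "- 1 \<in> carrier (polyring n :: 'k mpoly ring)"
      unfolding carrier_polyring supported_uminus by (simp add: supported_def)
    from assms(4)[OF m p] have "- p \<in> I" by simp
    moreover have "\<ominus>\<^bsub>polyring n\<^esub> p = - p"
      using p assms(1) \<open>- p \<in> I\<close> by (intro R.minus_equality) auto
    ultimately show "\<ominus>\<^bsub>polyring n\<^esub> p \<in> I" by simp
  qed (use assms in auto)
next
  fix a x assume "a \<in> I" "x \<in> carrier (polyring n :: 'k mpoly ring)"
  then show "x \<otimes>\<^bsub>polyring n\<^esub> a \<in> I" "a \<otimes>\<^bsub>polyring n\<^esub> x \<in> I"
    using assms(4)[of x a] by (simp_all add: mult.commute[of a x])
qed

lemma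
  fixes I :: "('k::field) mpoly set"
  assumes "ideal I (polyring n)"
  shows ideal_polyring_0: "0 \<in> I"
    and ideal_polyring_add: "p \<in> I \<Longrightarrow> q \<in> I \<Longrightarrow> p + q \<in> I"
    and ideal_polyring_mult: "r \<in> carrier (polyring n) \<Longrightarrow> p \<in> I \<Longrightarrow> r * p \<in> I"
    and ideal_polyring_sum: "(\<And>x. x \<in> X \<Longrightarrow> f x \<in> I) \<Longrightarrow> sum f X \<in> I"
proof -
  show 0: "0 \<in> I" using additive_subgroup.zero_closed[OF ideal.axioms(1)[OF assms]] by simp
  show add: "p \<in> I \<Longrightarrow> q \<in> I \<Longrightarrow> p + q \<in> I" for p q using additive_subgroup.a_closed[OF ideal.axioms(1)[OF assms], of p q] by simp
  show "r \<in> carrier (polyring n) \<Longrightarrow> p \<in> I \<Longrightarrow> r * p \<in> I" using ideal.I_l_closed[OF assms, of p r] by simp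
  show "(\<And>x. x \<in> X \<Longrightarrow> f x \<in> I) \<Longrightarrow> sum f X \<in> I"
    by (induction X rule: infinite_finite_induct) (auto intro: 0 add)
qed

lemma ideal_supported: "upclosed n T \<Longrightarrow> ideal (supported T) (polyring n)"
  unfolding upclosed_def
  by (rule ideal_polyringI) (auto simp: carrier_polyring intro: supported_add supported_mult dest: supported_mono)

definition multiples :: "nat \<Rightarrow> (nat \<Rightarrow>\<^sub>0 nat) set \<Rightarrow> (nat \<Rightarrow>\<^sub>0 nat) set" where
  "multiples n A = {l + a | l a. l \<in> mons n \<and> a \<in> A}"

lemma upclosed_multiples: "A \<subseteq> mons n \<Longrightarrow> upclosed n (multiples n A)"
  unfolding upclosed_def multiples_def by (auto; metis add.assoc mons_add)

lemma multiples_superset: "A \<subseteq> multiples n A"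
  unfolding multiples_def by (force intro: exI[of _ 0])

lemma monomial_image_carrier: "A \<subseteq> mons n \<Longrightarrow> monomial ` A \<subseteq> carrier (polyring n)"
  by (auto simp: carrier_polyring)

lemma Idl_monomials:
  assumes A: "A \<subseteq> mons n"
  shows "Idl\<^bsub>polyring n\<^esub> (monomial ` A) = (supported (multiples n A) :: ('k::field) mpoly set)" (is "?L = ?R")
proof (intro equalityI subsetI)
  interpret R: ring "polyring n :: 'k mpoly ring" by (rule ring_polyring)
  have "?L \<subseteq> ?R"
    using multiples_superset[of A n] by (intro R.genideal_minimal ideal_supported upclosed_multiples A) auto
  then show "p \<in> ?L \<Longrightarrow> p \<in> ?R" for p by blast
  fix p assume p: "p \<in> ?R"
  note idl = R.genideal_ideal[OF monomial_image_carrier[OF A]]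
  have "Poly_Mapping.single m (Poly_Mapping.lookup p m) \<in> ?L" if "m \<in> Poly_Mapping.keys p" for m
  proof -
    from that p obtain l a where la: "m = l + a" "l \<in> mons n" "a \<in> A" by (auto simp: supported_def multiples_def)
    have "monomial a \<in> ?L" using la(3) R.genideal_self[OF monomial_image_carrier[OF A]] by blast
    moreover have "Poly_Mapping.single l (Poly_Mapping.lookup p m) \<in> carrier (polyring n)"
      using la(2) by (simp add: carrier_polyring supported_def)
    ultimately have "Poly_Mapping.single l (Poly_Mapping.lookup p m) * monomial a \<in> ?L"
      by (intro ideal_polyring_mult[OF idl])
    then show ?thesis by (simp add: la(1) monomial_def mult_single)
  qed
  then have "(\<Sum>m\<in>Poly_Mapping.keys p. Poly_Mapping.single m (Poly_Mapping.lookup p m)) \<in> ?L"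
    by (rule ideal_polyring_sum[OF idl])
  then show "p \<in> ?L" by (simp add: sum_singles)
qed

lemma partial_deriv_superset:
  assumes "finite A" "Poly_Mapping.keys p \<subseteq> A"
  shows "partial_deriv i p = (\<Sum>m\<in>A. Poly_Mapping.single (m - Poly_Mapping.single i 1)
         (of_nat (Poly_Mapping.lookup m i) * Poly_Mapping.lookup p m))"
  unfolding partial_deriv_def by (rule sum.mono_neutral_left) (use assms in \<open>auto simp: in_keys_iff\<close>)

lemma partial_deriv_add: "partial_deriv i (p + q) = partial_deriv i p + partial_deriv i q"
  unfolding partial_deriv_def
  by (rule setsum_keys_plus_distrib) (simp_all add: algebra_simps single_add)

lemma lookup_const_mult:
  "Poly_Mapping.lookup (Poly_Mapping.single 0 c * p) m = c * Poly_Mapping.lookup (p :: ('k::field) mpoly) m"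
  unfolding mult_map_scale_conv_mult[symmetric] by (simp add: Poly_Mapping.map.rep_eq when_def)

lemma partial_deriv_const_mult:
  "partial_deriv i (Poly_Mapping.single 0 c * p) = Poly_Mapping.single 0 c * partial_deriv i p"
proof -
  have "Poly_Mapping.keys (Poly_Mapping.single 0 c * p) \<subseteq> Poly_Mapping.keys p"
    by (auto simp: in_keys_iff lookup_const_mult)
  from partial_deriv_superset[OF finite_keys this, of i] show ?thesis
    unfolding partial_deriv_def[of i p] sum_distrib_left mult_single lookup_const_mult
    by (simp add: mult.left_commute)
qed

lemma partial_deriv_monomial:
  "partial_deriv i (monomial m) = Poly_Mapping.single (m - Poly_Mapping.single i 1) (of_nat (Poly_Mapping.lookup m i))"
  by (simp add: partial_deriv_def monomial_def)

locale equigenerated =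
  fixes n d :: nat and A :: "(nat \<Rightarrow>\<^sub>0 nat) set" and I :: "('k::field) mpoly set"
  assumes A: "A \<subseteq> mons n" and deg: "\<And>a. a \<in> A \<Longrightarrow> mono_deg a = d"
    and I: "I = supported (multiples n A)"
begin

lemma Idl_A: "Idl\<^bsub>polyring n\<^esub> (monomial ` A) = I"
  using Idl_monomials[OF A] I by simp

lemma deg_multiples: "m \<in> multiples n A \<Longrightarrow> d \<le> mono_deg m"
  by (auto simp: multiples_def deg)

lemma multiples_of_degree: "m \<in> multiples n B \<Longrightarrow> B \<subseteq> A \<Longrightarrow> mono_deg m = d \<Longrightarrow> m \<in> B"
proof -
  assume "m \<in> multiples n B" "B \<subseteq> A" "mono_deg m = d"
  then obtain l a where la: "m = l + a" "a \<in> B" "a \<in> A" by (auto simp: multiples_def)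
  then have "mono_deg l = 0" using deg[OF la(3)] \<open>mono_deg m = d\<close> by simp
  then show "m \<in> B" using la by simp
qed

lemma ideal_I: "ideal I (polyring n)"
  unfolding I by (rule ideal_supported[OF upclosed_multiples[OF A]])

text \<open>
  A monomial generator dividing a monomial of the least degree \<open>d\<close> is equal to it.
\<close>

lemma monomial_generators_superset:
  assumes G: "G \<subseteq> monomials n" "Idl\<^bsub>polyring n\<^esub> G = I"
  shows "monomial ` A \<subseteq> G"
proof
  interpret R: ring "polyring n :: 'k mpoly ring" by (rule ring_polyring)
  obtain B where B: "G = monomial ` B" "B \<subseteq> mons n"
    using G(1) unfolding monomials_def mons_def by (meson subset_image_iff)
  have GI: "supported (multiples n B) = I"
    unfolding Idl_monomials[OF B(2), symmetric] using G(2) B(1) by simp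
  fix x :: "'k mpoly" assume "x \<in> monomial ` A"
  then obtain a where a: "a \<in> A" "x = monomial a" by blast
  have "monomial a \<in> I" unfolding I using a(1) multiples_superset by auto
  then have "a \<in> multiples n B" unfolding GI[symmetric] by simp
  then obtain l b where lb: "a = l + b" "b \<in> B" by (auto simp: multiples_def)
  have "monomial b \<in> I" unfolding GI[symmetric] using lb(2) multiples_superset by auto
  then have "b \<in> multiples n A" unfolding I by simp
  then have "d \<le> mono_deg b" by (rule deg_multiples)
  moreover have "mono_deg l + mono_deg b = d" using deg[OF a(1)] lb(1) by simp
  ultimately have "mono_deg l = 0" by linarith
  then have "l = 0" by simp
  then show "x \<in> G" using lb a B by simp
qed

lemma minimal_generating_set_A: "minimal_generating_set n I (monomial ` A)"
  unfolding minimal_generating_set_def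
proof (intro conjI allI impI)
  fix H :: "'k mpoly set" assume H: "H \<subset> monomial ` A"
  then have "H \<subseteq> monomials n" using A unfolding monomials_def mons_def by blast
  then show "Idl\<^bsub>polyring n\<^esub> H \<noteq> I" using monomial_generators_superset H by blast
qed (use A Idl_A in \<open>auto simp: carrier_polyring\<close>)

lemma minimal_monomial_generators_eq: "minimal_monomial_generators n I = monomial ` A"
  unfolding minimal_monomial_generators_def
proof (rule the_equality)
  show "monomial ` A \<subseteq> monomials n \<and> minimal_generating_set n I (monomial ` A)"
    using minimal_generating_set_A A by (auto simp: monomials_def mons_def)
  fix G assume G: "G \<subseteq> monomials n \<and> minimal_generating_set n I G"
  then have "monomial ` A \<subseteq> G" by (intro monomial_generators_superset) (auto simp: minimal_generating_set_def)
  then show "G = monomial ` A" using G Idl_A unfolding minimal_generating_set_def by blast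
qed

lemma minimal_homogeneous_generating_set_A: "minimal_homogeneous_generating_set n I (monomial ` A)"
  unfolding minimal_homogeneous_generating_set_def
proof (intro conjI ballI minimal_generating_set_A)
  fix g :: "'k mpoly" assume "g \<in> monomial ` A"
  then show "\<exists>e. homogeneous g e" by (auto simp: homogeneous_iff of_degree_def)
qed

lemma monomial_ideal_I: "monomial_ideal n I"
  unfolding monomial_ideal_def
proof (intro exI conjI)
  show "monomial ` A \<subseteq> monomials n" using A unfolding monomials_def mons_def by (rule image_mono)
qed (rule Idl_A[symmetric])

text \<open>
  No element of \<open>I\<close> has terms of degree less than \<open>d\<close>, so a term of positive degree of \<open>r\<close> contributes
  nothing to the component of degree \<open>d\<close> of \<open>r p\<close>.
\<close>

lemma restr_initial_degree_mult:
  assumes "p \<in> I"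
  shows "restr (of_degree (int d)) (r * p) = Poly_Mapping.single 0 (Poly_Mapping.lookup r 0) * restr (of_degree (int d)) p"
proof -
  let ?p = "restr (of_degree (int d)) p" and ?c = "Poly_Mapping.single 0 (Poly_Mapping.lookup r 0) :: 'k mpoly"
  let ?hi = "{m. d < mono_deg m}"
  have "multiples n A \<subseteq> of_degree (int d) \<union> ?hi" using deg_multiples by (force simp: of_degree_def)
  then have "p \<in> supported (of_degree (int d) \<union> ?hi)" using assms supported_mono unfolding I by blast
  then have p': "p - ?p \<in> supported ?hi" by (rule diff_restr_supported)
  have r': "r - ?c \<in> supported (- {0})" by (auto simp: supported_def in_keys_iff lookup_minus)
  have p: "?p \<in> supported (of_degree (int d))" by (rule restr_supported)
  have "(r - ?c) * ?p \<in> supported ?hi"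
  proof (rule supported_mult[OF r' p])
    fix m l :: "nat \<Rightarrow>\<^sub>0 nat" assume "m \<in> - {0}" "l \<in> of_degree (int d)"
    then have "0 < mono_deg m" "mono_deg l = d"
      using mono_deg_eq_0_iff[of m] by (auto simp only: neq0_conv[symmetric] Compl_iff singleton_iff of_degree_def mem_Collect_eq of_nat_eq_iff)
    then show "m + l \<in> ?hi" by simp
  qed
  moreover have "r * (p - ?p) \<in> supported ?hi"
    by (rule supported_mult[where T = UNIV, OF _ p']) auto
  ultimately have hi: "(r - ?c) * ?p + r * (p - ?p) \<in> supported ?hi" by (rule supported_add)
  have lo: "?c * ?p \<in> supported (of_degree (int d))"
    by (rule supported_mult[where T = "{0}", OF _ p]) (auto simp: supported_def)
  have "r * p = ?c * ?p + ((r - ?c) * ?p + r * (p - ?p))" by (simp add: algebra_simps)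
  then have "restr (of_degree (int d)) (r * p) = restr (of_degree (int d)) (?c * ?p)
      + restr (of_degree (int d)) ((r - ?c) * ?p + r * (p - ?p))" by (simp only: restr_add)
  also have "restr (of_degree (int d)) ((r - ?c) * ?p + r * (p - ?p)) = 0"
    by (rule restr_eq_0[OF hi]) (auto simp: of_degree_def)
  finally show ?thesis by (simp add: restr_id[OF lo])
qed

text \<open>
  The components of degree \<open>d\<close> of elements of \<open>I\<close> are \<open>K\<close>-linear combinations of the components of degree
  \<open>d\<close> of any generators of \<open>I\<close>, stated as an induction principle: by the previous lemma, the elements whose
  component satisfies a property that is closed under linear combinations form an ideal.
\<close>

lemma initial_degree_induct:
  assumes G: "G \<subseteq> carrier (polyring n)" "Idl\<^bsub>polyring n\<^esub> G = I"
    and P: "\<And>g. g \<in> G \<Longrightarrow> P (restr (of_degree (int d)) g)" "P 0" "\<And>p q. P p \<Longrightarrow> P q \<Longrightarrow> P (p + q)"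
      "\<And>c p. P p \<Longrightarrow> P (Poly_Mapping.single 0 c * p)"
    and p: "p \<in> I"
  shows "P (restr (of_degree (int d)) p)"
proof -
  interpret R: ring "polyring n :: 'k mpoly ring" by (rule ring_polyring)
  let ?Y = "{p \<in> I. P (restr (of_degree (int d)) p)}"
  have "ideal ?Y (polyring n)"
  proof (rule ideal_polyringI)
    show "?Y \<subseteq> carrier (polyring n)"
      using ideal.Icarr[OF ideal_I] by blast
    show "0 \<in> ?Y" using P(2) ideal_polyring_0[OF ideal_I] by simp
    show "p + q \<in> ?Y" if "p \<in> ?Y" "q \<in> ?Y" for p q
      using that P(3) ideal_polyring_add[OF ideal_I] by (simp add: restr_add)
    show "r * p \<in> ?Y" if "r \<in> carrier (polyring n)" "p \<in> ?Y" for r p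
      using that P(4) ideal_polyring_mult[OF ideal_I] by (simp add: restr_initial_degree_mult)
  qed
  moreover have "G \<subseteq> ?Y" using P(1) R.genideal_self[OF G(1)] G(2) by blast
  ultimately have "Idl\<^bsub>polyring n\<^esub> G \<subseteq> ?Y" by (rule R.genideal_minimal)
  then show ?thesis using p G(2) by blast
qed

lemma restr_monomial_A: "a \<in> A \<Longrightarrow> restr (of_degree (int d)) (monomial a) = monomial a"
  by (rule restr_id) (simp add: of_degree_def deg)

lemma monomial_A_in_I: "a \<in> A \<Longrightarrow> monomial a \<in> I"
  unfolding I using multiples_superset by auto

text \<open>
  The generators of degree \<open>d\<close> already generate all monomials in \<open>A\<close>, thus all of \<open>I\<close>, so by
  minimality there are no others.
\<close>

lemma minimal_homogeneous_generators_degree: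
  assumes "minimal_homogeneous_generating_set n I G"
  shows "G \<subseteq> supported (of_degree (int d))"
proof -
  interpret R: ring "polyring n :: 'k mpoly ring" by (rule ring_polyring)
  have G: "G \<subseteq> carrier (polyring n)" "Idl\<^bsub>polyring n\<^esub> G = I" "\<And>H. H \<subset> G \<Longrightarrow> Idl\<^bsub>polyring n\<^esub> H \<noteq> I"
    and hom: "\<And>g. g \<in> G \<Longrightarrow> \<exists>e. homogeneous g e"
    using assms by (auto simp: minimal_homogeneous_generating_set_def minimal_generating_set_def)
  let ?H = "G \<inter> supported (of_degree (int d))"
  have H: "?H \<subseteq> carrier (polyring n)" using G(1) by blast
  note idl = R.genideal_ideal[OF H]
  have "monomial a \<in> Idl\<^bsub>polyring n\<^esub> ?H" if "a \<in> A" for a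
  proof -
    have "restr (of_degree (int d)) (monomial a) \<in> Idl\<^bsub>polyring n\<^esub> ?H"
    proof (rule initial_degree_induct[OF G(1,2), where P = "\<lambda>p. p \<in> Idl\<^bsub>polyring n\<^esub> ?H"])
      fix g assume g: "g \<in> G"
      then obtain e where e: "g \<in> supported (of_degree e)" using hom by (auto simp: homogeneous_iff)
      show "restr (of_degree (int d)) g \<in> Idl\<^bsub>polyring n\<^esub> ?H"
      proof (cases "e = int d")
        case True
        then show ?thesis using g e R.genideal_self[OF H] by (auto simp: restr_id)
      next
        case False
        then have "restr (of_degree (int d)) g = 0" by (intro restr_eq_0[OF e]) (auto simp: of_degree_def)
        then show ?thesis using ideal_polyring_0[OF idl] by simp
      qed
    next
      fix c and p :: "'k mpoly" assume "p \<in> Idl\<^bsub>polyring n\<^esub> ?H"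
      then show "Poly_Mapping.single 0 c * p \<in> Idl\<^bsub>polyring n\<^esub> ?H"
        by (intro ideal_polyring_mult[OF idl]) (auto simp: carrier_polyring supported_def)
    qed (use ideal_polyring_0[OF idl] ideal_polyring_add[OF idl] monomial_A_in_I[OF that] in auto)
    then show ?thesis by (simp add: restr_monomial_A that)
  qed
  then have "I \<subseteq> Idl\<^bsub>polyring n\<^esub> ?H"
    unfolding Idl_A[symmetric] by (intro R.genideal_minimal[OF idl]) blast
  moreover have "Idl\<^bsub>polyring n\<^esub> ?H \<subseteq> I"
    using R.genideal_self[OF G(1)] G(2) by (intro R.genideal_minimal[OF ideal_I]) blast
  ultimately have "Idl\<^bsub>polyring n\<^esub> ?H = I" by blast
  then have "?H = G" using G(3)[of ?H] by blast
  then show ?thesis by blast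
qed

definition quotients :: "(nat \<Rightarrow>\<^sub>0 nat) set" where
  "quotients = {a - Poly_Mapping.single i 1 | a i. a \<in> A \<and> i \<in> Poly_Mapping.keys a}"

lemma quotients_mons: "quotients \<subseteq> mons n"
proof
  fix m assume "m \<in> quotients"
  then obtain a i where a: "a \<in> A" "m = a - Poly_Mapping.single i 1" by (auto simp: quotients_def)
  have "Poly_Mapping.keys m \<subseteq> Poly_Mapping.keys a"
    by (auto simp: a in_keys_iff lookup_minus)
  then show "m \<in> mons n" using a A by (auto simp: mons_def)
qed

text \<open>
  The minimal generating set \<open>G\<close> used in the definition of the gradient ideal is arbitrary and need not
  consist of monomials. But each monomial in \<open>A\<close> is a \<open>K\<close>-linear combination of \<open>G\<close> and conversely, and
  derivatives are linear. For a squarefree monomial the derivatives have coefficients \<open>0\<close> and \<open>1\<close>, in any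
  characteristic.
\<close>

lemma gradient_ideal_eq:
  assumes sqf: "\<forall>a\<in>A. \<forall>i. Poly_Mapping.lookup a i \<le> 1"
  shows "gradient_ideal n I = supported (multiples n quotients)"
proof -
  interpret R: ring "polyring n :: 'k mpoly ring" by (rule ring_polyring)
  define G where "G = (SOME G. minimal_homogeneous_generating_set n I G)"
  have mG: "minimal_homogeneous_generating_set n I G"
    unfolding G_def by (rule someI[of _ "monomial ` A"]) (rule minimal_homogeneous_generating_set_A)
  have G: "G \<subseteq> carrier (polyring n)" "Idl\<^bsub>polyring n\<^esub> G = I"
    using mG by (auto simp: minimal_homogeneous_generating_set_def minimal_generating_set_def)
  have Gd: "G \<subseteq> supported (of_degree (int d))" by (rule minimal_homogeneous_generators_degree[OF mG])
  let ?D = "{partial_deriv i f | i f. i < n \<and> f \<in> G}"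
  have grad: "gradient_ideal n I = Idl\<^bsub>polyring n\<^esub> ?D"
    unfolding gradient_ideal_def G_def ..
  have D: "?D \<subseteq> supported (multiples n quotients)"
  proof
    fix x assume "x \<in> ?D"
    then obtain i g where g: "g \<in> G" "x = partial_deriv i g" by blast
    show "x \<in> supported (multiples n quotients)" unfolding g(2) partial_deriv_def
    proof (rule supported_sum)
      fix m assume m: "m \<in> Poly_Mapping.keys g"
      have "g \<in> I" using R.genideal_self[OF G(1)] G(2) g(1) by blast
      then have "m \<in> multiples n A" "mono_deg m = d"
        using g(1) Gd m unfolding I by (auto simp: supported_def of_degree_def)
      then have mA: "m \<in> A" using multiples_of_degree by blast
      show "Poly_Mapping.single (m - Poly_Mapping.single i 1) (of_nat (Poly_Mapping.lookup m i) * Poly_Mapping.lookup g m)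
         \<in> supported (multiples n quotients)"
      proof (cases "i \<in> Poly_Mapping.keys m")
        case True
        then have "m - Poly_Mapping.single i 1 \<in> quotients" using mA by (auto simp: quotients_def)
        then show ?thesis using multiples_superset[of quotients n] by (auto simp: supported_def)
      qed (simp add: in_keys_iff)
    qed
  qed
  have up: "upclosed n (multiples n quotients)" by (rule upclosed_multiples[OF quotients_mons])
  have Dc: "?D \<subseteq> carrier (polyring n)"
    using D up supported_mono[of "multiples n quotients" "mons n"] unfolding carrier_polyring upclosed_def by blast
  note idl = R.genideal_ideal[OF Dc]
  have "monomial ` quotients \<subseteq> Idl\<^bsub>polyring n\<^esub> ?D"
  proof
    fix x :: "'k mpoly" assume "x \<in> monomial ` quotients"
    then obtain a i where a: "a \<in> A" "i \<in> Poly_Mapping.keys a" "x = monomial (a - Poly_Mapping.single i 1)"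
      by (auto simp: quotients_def)
    have i: "i < n" using a A by (auto simp: mons_def)
    have "Poly_Mapping.lookup a i = 1" using sqf a(1,2) by (metis One_nat_def in_keys_iff le_Suc_eq le_zero_eq)
    then have x: "x = partial_deriv i (monomial a)"
      by (simp add: a(3) partial_deriv_monomial) (simp add: monomial_def)
    have "partial_deriv i (restr (of_degree (int d)) (monomial a)) \<in> Idl\<^bsub>polyring n\<^esub> ?D"
    proof (rule initial_degree_induct[OF G, where P = "\<lambda>p. partial_deriv i p \<in> Idl\<^bsub>polyring n\<^esub> ?D"])
      fix g assume g: "g \<in> G"
      then have "partial_deriv i g \<in> Idl\<^bsub>polyring n\<^esub> ?D" using i R.genideal_self[OF Dc] by blast
      then show "partial_deriv i (restr (of_degree (int d)) g) \<in> Idl\<^bsub>polyring n\<^esub> ?D"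
        using g Gd restr_id by fastforce
    next
      fix c and p :: "'k mpoly" assume "partial_deriv i p \<in> Idl\<^bsub>polyring n\<^esub> ?D"
      then show "partial_deriv i (Poly_Mapping.single 0 c * p) \<in> Idl\<^bsub>polyring n\<^esub> ?D"
        unfolding partial_deriv_const_mult
        by (intro ideal_polyring_mult[OF idl]) (auto simp: carrier_polyring supported_def)
    next
      show "partial_deriv i 0 \<in> Idl\<^bsub>polyring n\<^esub> ?D" using ideal_polyring_0[OF idl] by (simp add: partial_deriv_def)
    next
      fix p q :: "'k mpoly"
      assume "partial_deriv i p \<in> Idl\<^bsub>polyring n\<^esub> ?D" "partial_deriv i q \<in> Idl\<^bsub>polyring n\<^esub> ?D"
      then show "partial_deriv i (p + q) \<in> Idl\<^bsub>polyring n\<^esub> ?D"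
        unfolding partial_deriv_add by (rule ideal_polyring_add[OF idl])
    qed (rule monomial_A_in_I[OF a(1)])
    then show "x \<in> Idl\<^bsub>polyring n\<^esub> ?D" unfolding x by (simp add: restr_monomial_A[OF a(1)])
  qed
  then have "Idl\<^bsub>polyring n\<^esub> (monomial ` quotients) \<subseteq> Idl\<^bsub>polyring n\<^esub> ?D"
    by (rule R.genideal_minimal[OF idl])
  then have "supported (multiples n quotients) \<subseteq> Idl\<^bsub>polyring n\<^esub> ?D"
    unfolding Idl_monomials[OF quotients_mons] .
  moreover have "Idl\<^bsub>polyring n\<^esub> ?D \<subseteq> supported (multiples n quotients)"
    by (rule R.genideal_minimal[OF ideal_supported[OF up] D])
  ultimately show ?thesis unfolding grad by blast
qed

lemma gradient_by_monomials_I: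
  assumes sqf: "\<forall>a\<in>A. \<forall>i. Poly_Mapping.lookup a i \<le> 1"
  shows "gradient_by_monomials n I"
proof -
  have "monomial m \<in> minimal_monomial_generators n I \<longleftrightarrow> m \<in> A" for m
  proof -
    have "inj (monomial :: _ \<Rightarrow> 'k mpoly)"
      by (rule injI) (metis keys_single monomial_def one_neq_zero singleton_inject)
    then show ?thesis unfolding minimal_monomial_generators_eq by (simp add: inj_image_mem_iff)
  qed
  then have "{monomial (m - Poly_Mapping.single i 1) | m i.
          monomial m \<in> minimal_monomial_generators n I \<and> i \<in> Poly_Mapping.keys m} = (monomial ` quotients :: 'k mpoly set)"
    by (auto simp: quotients_def)
  then show ?thesis
    unfolding gradient_by_monomials_def gradient_ideal_eq[OF sqf] by (simp add: Idl_monomials[OF quotients_mons])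
qed

end

section \<open>The cubic ideal and its gradient ideal\<close>

text \<open>
  The regularity takes every resolution of the residue field into account: the upper bound is needed for all
  of them, and the attainment for one, which is provided by the Koszul complex.
\<close>

lemma regularity_eqI:
  fixes T :: "(nat \<Rightarrow>\<^sub>0 nat) set" and r :: int
  assumes "\<And>(C :: ('k::field) free_complex) \<epsilon>. residue_field_resolution n C \<epsilon> \<Longrightarrow>
     residue_field_resolution.reg_le C T r \<and> residue_field_resolution.attains C T r"
  shows "regularity n (supported T :: 'k mpoly set) = ereal (real_of_int r)"
proof -
  let ?I = "supported T :: 'k mpoly set"
  have upper: "j - int i \<le> r" if nz: "Tor_nonzero n ?I i j" for i j
  proof -
    obtain C \<epsilon> where C: "graded_free_resolution_of_residue_field n C \<epsilon>"
        "graded_cycles C ?I i j \<noteq> graded_boundaries C ?I i j"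
      using nz by (auto simp: Tor_nonzero_def)
    interpret residue_field_resolution n C \<epsilon> using C(1) by unfold_locales
    have "reg_le T r" using assms[OF residue_field_resolution_axioms] by blast
    then show ?thesis using C(2) unfolding reg_le_def vanishes_def by (meson not_le)
  qed
  obtain C :: "'k free_complex" and \<epsilon> where C: "graded_free_resolution_of_residue_field n C \<epsilon>"
    using resolution_of_residue_field_exists by blast
  interpret residue_field_resolution n C \<epsilon> using C by unfold_locales
  have "attains T r" using assms[OF residue_field_resolution_axioms] by blast
  then obtain i j where "j - int i = r" "Tor_nonzero n ?I i j"
    using C unfolding attains_def vanishes_def Tor_nonzero_def by blast
  then have "ereal (real_of_int r) \<in> {ereal (real_of_int (j - int i)) | i j. Tor_nonzero n ?I i j}"
    by blast
  moreover have "x \<le> ereal (real_of_int r)" if x: "x \<in> {ereal (real_of_int (j - int i)) | i j. Tor_nonzero n ?I i j}" for x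
  proof -
    obtain i j where ij: "x = ereal (real_of_int (j - int i))" "Tor_nonzero n ?I i j" using x by blast
    show ?thesis unfolding ij(1) using upper[OF ij(2)] by (simp only: ereal_less_eq of_int_le_iff)
  qed
  ultimately show ?thesis unfolding regularity_def by (intro antisym Sup_least Sup_upper)
qed

lemma multiples_var_prods:
  assumes "\<And>U. U \<in> \<U> \<Longrightarrow> U \<subseteq> {..<n}"
  shows "multiples n (var_prod ` \<U>) = sqfree n {X. \<exists>U\<in>\<U>. U \<subseteq> X}" (is "?L = ?R")
proof (intro equalityI subsetI)
  have fin: "finite U" if "U \<in> \<U>" for U using assms[OF that] finite_subset by blast
  {
    fix m assume "m \<in> ?L"
    then obtain l U where lU: "m = l + var_prod U" "l \<in> mons n" "U \<in> \<U>" by (auto simp: multiples_def)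
    then show "m \<in> ?R" using var_prod_mons[OF assms[OF lU(3)]] fin
      by (auto simp: sqfree_def keys_add_nat)
  next
    fix m assume "m \<in> ?R"
    then obtain U where U: "U \<in> \<U>" "U \<subseteq> Poly_Mapping.keys m" and m: "m \<in> mons n" by (auto simp: sqfree_def)
    note eq = var_prod_divides[OF fin[OF U(1)] U(2)]
    from m have "(m - var_prod U) + var_prod U \<in> mons n" using eq by simp
    then have "m - var_prod U \<in> mons n" by (simp only: mons_add)
    then have "(m - var_prod U) + var_prod U \<in> ?L" using U(1) unfolding multiples_def by blast
    then show "m \<in> ?L" using eq by simp
  }
qed

lemma var_prod_diff_single:
  "finite U \<Longrightarrow> i \<in> U \<Longrightarrow> var_prod U - Poly_Mapping.single i 1 = var_prod (U - {i})"
  by (rule poly_mapping_eqI) (simp add: lookup_minus lookup_var_prod lookup_single when_def)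

text \<open>
  The supports of the minimal generators: \<open>a\<^sub>k b\<^sub>k z\<^sub>k\<close>, and the squarefree cubics with two \<open>z\<close>'s, whose two
  larger indices are at least \<open>2s\<close>.
\<close>

definition triples :: "nat \<Rightarrow> nat set set" where
  "triples s = {{2 * k, 2 * k + 1, 2 * s + k} | k. k < s} \<union>
     {{v, y, z} | v y z. v < y \<and> y < z \<and> 2 * s \<le> y \<and> z < 3 * s}"

lemma triples_subset: "U \<in> triples s \<Longrightarrow> U \<subseteq> {..<3 * s}"
  by (auto simp: triples_def)

lemma card_triples: "U \<in> triples s \<Longrightarrow> card U = 3"
  by (auto simp: triples_def)

lemma cubics_eq_triples: "cubics s s = {X. \<exists>U\<in>triples s. U \<subseteq> X}"
proof (intro equalityI subsetI CollectI)
  fix X assume "X \<in> cubics s s"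
  then obtain i where i: "i < s" "2 * s + i \<in> X" "X \<in> staircase (2 * s) i (containing {2 * i, 2 * i + 1})"
    by (auto simp: cubics_def)
  from i(3) consider "{2 * i, 2 * i + 1} \<subseteq> X"
    | y v where "y \<in> X" "2 * s \<le> y" "y < 2 * s + i" "v < y" "v \<in> X"
    by (auto simp: staircase_def containing_def touching_def)
  then show "\<exists>U\<in>triples s. U \<subseteq> X"
  proof cases
    case 1
    then show ?thesis using i by (intro bexI[of _ "{2 * i, 2 * i + 1, 2 * s + i}"]) (auto simp: triples_def)
  next
    case 2
    moreover have "2 * s + i < 3 * s" using i by simp
    ultimately have "{v, y, 2 * s + i} \<in> triples s" unfolding triples_def by blast
    then show ?thesis using 2 i by (intro bexI[of _ "{v, y, 2 * s + i}"]) auto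
  qed
next
  fix X assume "X \<in> {X. \<exists>U\<in>triples s. U \<subseteq> X}"
  then consider k where "k < s" "{2 * k, 2 * k + 1, 2 * s + k} \<subseteq> X"
    | v y z where "v < y" "y < z" "2 * s \<le> y" "z < 3 * s" "{v, y, z} \<subseteq> X"
    unfolding triples_def by blast
  then show "X \<in> cubics s s"
  proof cases
    case 1
    then show ?thesis by (auto simp: cubics_def staircase_def containing_def)
  next
    case 2
    then have "z - 2 * s < s" "2 * s + (z - 2 * s) = z" by auto
    then show ?thesis using 2 unfolding cubics_def staircase_def touching_def
      by (intro CollectI exI[of _ "z - 2 * s"]) auto
  qed
qed

text \<open>
  The pair \<open>a\<^sub>k b\<^sub>k\<close> is obtained from \<open>a\<^sub>k b\<^sub>k z\<^sub>k\<close>. A pair \<open>{v, z}\<close> with \<open>v < z\<close> and \<open>z \<ge> 2s\<close> is completed to a triple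
  by the largest index \<open>3s - 1\<close>, unless \<open>z\<close> is this index. In that case the missing element is \<open>0\<close> if \<open>v\<close> is
  itself a \<open>z\<close>-index, the smallest \<open>z\<close>-index \<open>2s\<close> if \<open>v < 2s\<close> and \<open>s > 1\<close>, and for \<open>s = 1\<close> the only triple
  \<open>{0, 1, 2}\<close> works.
\<close>

lemma staircase_pairs_eq:
  assumes "0 < s"
  shows "staircase (2 * s) s (pairs s) = {X. \<exists>U\<in>triples s. \<exists>i\<in>U. U - {i} \<subseteq> X}"
proof (intro equalityI subsetI CollectI)
  fix X assume "X \<in> staircase (2 * s) s (pairs s)"
  then consider k where "k < s" "{2 * k, 2 * k + 1} \<subseteq> X"
    | z v where "z \<in> X" "2 * s \<le> z" "z < 3 * s" "v < z" "v \<in> X"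
    by (auto simp: staircase_def pairs_def containing_def touching_def)
  then have "\<exists>U i. U \<in> triples s \<and> i \<in> U \<and> U - {i} \<subseteq> X"
  proof cases
    case 1
    then show ?thesis
      by (intro exI[of _ "{2 * k, 2 * k + 1, 2 * s + k}"] exI[of _ "2 * s + k"]) (auto simp: triples_def)
  next
    case 2
    let ?z = "3 * s - 1"
    consider "z < ?z" | "z = ?z" "2 * s \<le> v" | "z = ?z" "v < 2 * s" "s = 1" | "z = ?z" "v < 2 * s" "1 < s"
      using 2 assms by linarith
    then show ?thesis
    proof cases
      case 1
      then have "{v, z, ?z} \<in> triples s" using 2 assms unfolding triples_def by force
      then show ?thesis using 2 by (intro exI[of _ "{v, z, ?z}"] exI[of _ ?z]) auto
    next
      case 2
      then have "0 < v" "v < z" "z < 3 * s" using \<open>v < z\<close> assms by auto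
      then have "{0, v, z} \<in> triples s" using 2 unfolding triples_def by blast
      then show ?thesis using \<open>z \<in> X\<close> \<open>v \<in> X\<close> by (intro exI[of _ "{0, v, z}"] exI[of _ 0]) auto
    next
      case 3
      then have "{0, 1, 2} \<in> triples s" by (auto simp: triples_def)
      moreover have "v = 0 \<or> v = 1" "z = 2" using 3 by auto
      ultimately show ?thesis using \<open>z \<in> X\<close> \<open>v \<in> X\<close>
        by (intro exI[of _ "{0, 1, 2}"] exI[of _ "1 - v"]) auto
    next
      case 4
      then have "2 * s < z" "z < 3 * s" by auto
      then have "{v, 2 * s, z} \<in> triples s" using 4 unfolding triples_def by blast
      then show ?thesis using \<open>z \<in> X\<close> \<open>v \<in> X\<close> by (intro exI[of _ "{v, 2 * s, z}"] exI[of _ "2 * s"]) auto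
    qed
  qed
  then show "\<exists>U\<in>triples s. \<exists>i\<in>U. U - {i} \<subseteq> X" by blast
next
  fix X assume "X \<in> {X. \<exists>U\<in>triples s. \<exists>i\<in>U. U - {i} \<subseteq> X}"
  then obtain U i where U: "U \<in> triples s" "i \<in> U" "U - {i} \<subseteq> X" by blast
  have keep: "w \<in> X" if "w \<in> U" "w \<noteq> i" for w using U(3) that by blast
  have edge: "X \<in> staircase (2 * s) s (pairs s)" if "v \<in> X" "z \<in> X" "v < z" "2 * s \<le> z" "z < 3 * s" for v z
    using that by (auto simp: staircase_def touching_def)
  from U(1) consider k where "k < s" "U = {2 * k, 2 * k + 1, 2 * s + k}"
    | v y z where "v < y" "y < z" "2 * s \<le> y" "z < 3 * s" "U = {v, y, z}"
    unfolding triples_def by blast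
  then show "X \<in> staircase (2 * s) s (pairs s)"
  proof cases
    case 1
    then consider "i = 2 * k" | "i = 2 * k + 1" | "i = 2 * s + k" using U(2) by blast
    then show ?thesis
    proof cases
      case i: 1
      have "2 * k + 1 \<in> X" "2 * s + k \<in> X" by (rule keep; use 1 i in simp)+
      then show ?thesis by (rule edge) (use 1(1) in simp_all)
    next
      case i: 2
      have "2 * k \<in> X" "2 * s + k \<in> X" by (rule keep; use 1 i in simp)+
      then show ?thesis by (rule edge) (use 1(1) in simp_all)
    next
      case i: 3
      have "2 * k \<in> X" "2 * k + 1 \<in> X" by (rule keep; use 1 i in simp)+
      then show ?thesis using 1(1) by (auto simp: staircase_def pairs_def containing_def)
    qed
  next
    case 2
    then consider "i = v" | "i = y" | "i = z" using U(2) by blast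
    then show ?thesis
    proof cases
      case i: 1
      have "y \<in> X" "z \<in> X" by (rule keep; use 2 i in simp)+
      then show ?thesis by (rule edge) (use 2 in simp_all)
    next
      case i: 2
      have "v \<in> X" "z \<in> X" by (rule keep; use 2 i in simp)+
      then show ?thesis by (rule edge) (use 2 in simp_all)
    next
      case i: 3
      have "v \<in> X" "y \<in> X" by (rule keep; use 2 i in simp)+
      then show ?thesis by (rule edge) (use 2 in simp_all)
    qed
  qed
qed

theorem theorem2p3:
  fixes a :: int
  assumes "a \<ge> -1"
  shows "\<exists>n>0. \<exists>I :: ('k::field) mpoly set.
           monomial_ideal n I \<and> gradient_by_monomials n I \<and> linear_resolution n I \<and>
           regularity n (gradient_ideal n I) - regularity n I = ereal (real_of_int a)"
proof -
  define s where "s = nat (a + 2)"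
  have s: "0 < s" "int s = a + 2" using assms by (auto simp: s_def)
  define n where "n = 3 * s"
  have n: "0 < n" "2 * s + s \<le> n" "3 * s \<le> n" "2 * s \<le> n" using s by (auto simp: n_def)
  define A where "A = var_prod ` triples s"
  define I :: "'k mpoly set" where "I = supported (multiples n A)"
  have sub: "U \<subseteq> {..<n}" and fin: "finite U" if "U \<in> triples s" for U
    using triples_subset[OF that] finite_subset[of U "{..<n}"] by (auto simp: n_def)
  interpret equigenerated n 3 A I
    using sub fin card_triples by unfold_locales (auto simp: A_def I_def intro: var_prod_mons)
  have sqf: "\<forall>m\<in>A. \<forall>i. Poly_Mapping.lookup m i \<le> 1"
    using fin by (auto simp: A_def lookup_var_prod)
  have "quotients = var_prod ` {U - {i} | U i. U \<in> triples s \<and> i \<in> U}" (is "_ = var_prod ` ?E")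
  proof -
    have quot: "var_prod U - Poly_Mapping.single i 1 = var_prod (U - {i})" if "U \<in> triples s" "i \<in> U" for U i
      by (rule var_prod_diff_single[OF fin[OF that(1)] that(2)])
    show ?thesis
    proof (intro equalityI subsetI)
      fix m assume "m \<in> quotients"
      then obtain b i where b: "b \<in> A" "i \<in> Poly_Mapping.keys b" "m = b - Poly_Mapping.single i 1"
        by (auto simp: quotients_def)
      from b(1) obtain U where "U \<in> triples s" "b = var_prod U" by (auto simp: A_def)
      with b have U: "U \<in> triples s" "i \<in> Poly_Mapping.keys (var_prod U)"
        "m = var_prod U - Poly_Mapping.single i 1" by simp_all
      then have "i \<in> U" "m = var_prod (U - {i})" using fin[OF U(1)] quot[OF U(1)] by simp_all
      then show "m \<in> var_prod ` ?E" using U(1) by blast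
    next
      fix m assume "m \<in> var_prod ` ?E"
      then obtain U i where U: "U \<in> triples s" "i \<in> U" "m = var_prod (U - {i})" by blast
      have "i \<in> Poly_Mapping.keys (var_prod U)" using fin[OF U(1)] U(2) by simp
      then show "m \<in> quotients"
        unfolding U(3) quot[OF U(1,2), symmetric] quotients_def using U(1)
        by (intro CollectI exI[of _ "var_prod U"] exI[of _ i]) (simp add: A_def)
    qed
  qed
  moreover have "multiples n (var_prod ` ?E) = sqfree n {X. \<exists>E\<in>?E. E \<subseteq> X}"
  proof (rule multiples_var_prods)
    fix E assume "E \<in> ?E"
    then obtain U i where "U \<in> triples s" "E = U - {i}" by blast
    then show "E \<subseteq> {..<n}" using sub[of U] by blast
  qed
  ultimately have "multiples n quotients = sqfree n {X. \<exists>E\<in>?E. E \<subseteq> X}" by simp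
  also have "{X. \<exists>E\<in>?E. E \<subseteq> X} = staircase (2 * s) s (pairs s)"
    unfolding staircase_pairs_eq[OF s(1)] by blast
  finally have grad: "gradient_ideal n I = supported (sqfree n (staircase (2 * s) s (pairs s)))"
    using gradient_ideal_eq[OF sqf] by simp
  have cub: "multiples n A = sqfree n (cubics s s)"
    unfolding A_def cubics_eq_triples by (rule multiples_var_prods) (rule sub)

  have reg_I: "regularity n I = ereal (real_of_int 3)"
    unfolding I_def
  proof (rule regularity_eqI)
    fix C :: "'k free_complex" and \<epsilon> assume "residue_field_resolution n C \<epsilon>"
    then interpret residue_field_resolution n C \<epsilon> .
    have "{0, 1, 2 * s} \<in> triples s" using s(1) by (force simp: triples_def)
    then obtain m where m: "m \<in> A" by (auto simp: A_def)
    have "attains (multiples n A) (int (mono_deg m))"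
      using m multiples_superset[of A n] deg_multiples deg[OF m]
      by (intro attains_initial_degree upclosed_multiples A) auto
    then show "reg_le (multiples n A) 3 \<and> attains (multiples n A) 3"
      using reg_le_cubics[of s s] n deg[OF m] by (simp add: cub)
  qed
  have reg_grad: "regularity n (gradient_ideal n I) = ereal (real_of_int (int s + 1))"
    unfolding grad
  proof (rule regularity_eqI)
    fix C :: "'k free_complex" and \<epsilon> assume "residue_field_resolution n C \<epsilon>"
    then interpret residue_field_resolution n C \<epsilon> .
    have 1: "X \<inter> {..<2 * s} \<in> pairs s" if "X \<in> pairs s" for X
      using that by (fastforce simp: pairs_def containing_def)
    have 2: "{} \<notin> pairs s" by (auto simp: pairs_def containing_def)
    have 3: "2 \<le> int s + 1" using s by simp
    note P = pairs_regularity[OF n(4) s(1)]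
    show "reg_le (sqfree n (staircase (2 * s) s (pairs s))) (int s + 1) \<and>
        attains (sqfree n (staircase (2 * s) s (pairs s))) (int s + 1)"
      using staircase_regularity[OF upward_pairs 1 2 n(2) 3] P by blast
  qed
  have "linear_resolution n I"
    unfolding linear_resolution_def d_linear_resolution_def
    using minimal_homogeneous_generators_degree reg_I
    by (intro exI[of _ 3]) (auto simp: homogeneous_iff)
  moreover have "regularity n (gradient_ideal n I) - regularity n I = ereal (real_of_int a)"
    unfolding reg_grad reg_I using s by simp
  ultimately show ?thesis
    using n(1) monomial_ideal_I gradient_by_monomials_I[OF sqf] by blast
qed

end
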